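(* Let $(c_n)_{n\ge 0}$ be the sequence of rational numbers determined by $c_0=1$ and $$\sum_{k=0}^{N}\frac{c_k}{N+k+1}=0\qquad (N\ge 1),$$ and let $C_N=\sum_{k=0}^{N}c_k$. Let $\alpha_1$ be the smallest real part among the zeros of the meromorphic function $g^*(z)=z\bigl(\psi(-z/2)-\psi((1-z)/2)\bigr)$ (numerically $\alpha_1\approx 1.3465$). Then for every $\varepsilon>0$, $$C_N=O_\varepsilon\bigl(N^{-\alpha_1+\varepsilon}\bigr)\qquad (N\to\infty).$$
   Context: $\psi$ denotes the digamma function. The function $g^*$ is the modified Mellin transform of $g(t)=2/(1+t)$: for $\operatorname{Re}(z)<0$, $g^*(z)=-z\int_0^1 g(t)\,t^{-z-1}\,dt$, and $g^*$ is extended to $\mathbb{C}$ meromorphically by the digamma formula (its value at $z=0$ is $2$). The recurrence determines each $c_N$ uniquely since the coefficient of $c_N$ in the $N$-th equation is $1/(2N+1)\neq 0$. *)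

theory Defs
  imports
    "HOL-Complex_Analysis.Complex_Analysis"
    "HOL-Library.Landau_Symbols"
begin

text \<open>
  The point \<open>0\<close> is a removable singularity of the digamma expression, with limit \<open>2\<close>; the
  library's total \<^const>\<open>Digamma\<close> would give the value \<open>0\<close> there.
\<close>

definition gstar :: "complex \<Rightarrow> complex" where
  "gstar z = (if z = 0 then 2 else z * (Digamma (- z / 2) - Digamma ((1 - z) / 2)))"

text \<open>
  Poles (the positive integers) have to be excluded explicitly, because \<^const>\<open>gstar\<close>, being a
  total function, has a meaningless finite value there.
\<close>

definition gstar_zeros :: "complex set" where
  "gstar_zeros = {z. \<not> is_pole gstar z \<and> gstar z = 0}"

definition alpha1 :: real where
  "alpha1 = (LEAST x. x \<in> Re ` gstar_zeros)"

end

theory Submission imports Defs "HOL-Probability.Probability" "HOL-Real_Asymp.Real_Asymp" begin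

text \<open>
  Summation by parts turns the recurrence into
  \<open>C N = - (\<Sum>k<N. (2 N + 1) / ((N + k + 1) (N + k + 2)) C k)\<close>. The weights add up to \<open>N / (N + 1)\<close>,
  so \<open>\<bar>C N\<bar> \<le> 1\<close>. In the variable \<open>v = ln N\<close> this is, up to a small defect \<open>e\<close>, the convolution
  equation \<open>x + k * x = e\<close> on the half line with \<open>k v = 2 exp (- v) / (1 + exp (- v))\<^sup>2\<close>, and
  \<open>1 + k\<close> has the Laplace transform \<open>gstar (- q)\<close>. Hence the transform of \<open>x\<close> is that of \<open>e\<close> divided
  by \<open>gstar (- q)\<close>, and moving the inversion contour to \<open>Re q = - s\<close> with \<open>s < alpha1\<close> gives
  \<open>x = O(exp (- s v))\<close> as long as \<open>e\<close> decays faster than \<open>exp (- s v)\<close>. A bound \<open>C N = O(N powr - r)\<close>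
  with \<open>0 \<le> r < 1\<close> yields \<open>e = O(exp (- (1 + r) v))\<close>, so two rounds (\<open>r = 0\<close>, then \<open>r = s / 2\<close>) suffice
  provided \<open>s < 2\<close>. That \<open>alpha1 < 2\<close>, and that the minimum defining it is attained, follows from an
  argument variation count on the strip \<open>0 \<le> Re z \<le> 2\<close> together with the asymptotics of \<open>gstar\<close>.
\<close>

text \<open>The weights of the recurrence are close to \<open>2 X / (X + t)\<^sup>2\<close>, which
  is homogeneous of degree -1; this is why the recurrence becomes a convolution in the logarithmic
  variable. The obstacle is the number 2. The discrete and the continuous kernel differ by O(1 /
  X^2) in each term, so the estimate of the defect gains a full power over a bound with exponent r
  only while the sum of (k + 1)^(-r) still grows like N^(1 - r), and summing absolute values cannot
  take it beyond exp (- 2 v). Every s below \<open>alpha1\<close> is reached because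
  \<open>alpha1\<close> is less than 2, which is shown by a topological argument without locating a
  zero numerically. To the right of \<open>- alpha1\<close> the absence of zeros is just minimality.
  The inversion has two difficulties. The unknown is a step function with a jump at 0, so its
  transform is not integrable on vertical lines and only a continuous part of it is inverted. The
  pole of \<open>gstar (- q)\<close> at q = -1 may lie between the two contours, but it is a zero of
  the reciprocal, which is why the numerator \<open>gstar_num\<close> is used throughout.\<close>

section \<open>The alternating digamma difference and the numerator of \<open>gstar\<close>\<close>

text \<open>Nielsen's beta function, the meromorphic continuation of \<open>\<Sum>k. (- 1) ^ k / (w + k)\<close>.\<close>

definition nielsen_beta :: "complex \<Rightarrow> complex" where
  "nielsen_beta w = (Digamma ((w + 1) / 2) - Digamma (w / 2)) / 2"

lemma plus_of_nat_neq_zero: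
  fixes w :: complex
  assumes "Re w > 0"
  shows "w + of_nat n \<noteq> 0" "w + 2 * of_nat n \<noteq> 0" "w + 2 * of_nat n + 1 \<noteq> 0" "w + 2 * of_nat n + 2 \<noteq> 0"
  using assms by (auto simp: complex_eq_iff)

text \<open>The logarithms in the limit formulas for the two digamma values cancel. Pairing the
  terms 2 n and 2 n + 1 of the alternating series makes it absolutely convergent, which all later
  estimates rely on.\<close>

lemma nielsen_beta_sums:
  assumes w: "Re w > 0"
  shows "(\<lambda>n. 1 / ((w + 2 * of_nat n) * (w + 2 * of_nat n + 1))) sums nielsen_beta w"
proof -
  have nz: "w / 2 \<noteq> 0" "(w + 1) / 2 \<noteq> 0"
    using w by (auto simp: complex_eq_iff)
  have "(\<lambda>m. ((of_real (ln (real m)) - (\<Sum>n<m. inverse ((w + 1) / 2 + of_nat n))) -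
             (of_real (ln (real m)) - (\<Sum>n<m. inverse (w / 2 + of_nat n)))) / 2)
           \<longlonglongrightarrow> nielsen_beta w"
    unfolding nielsen_beta_def
    by (intro tendsto_divide tendsto_diff Digamma_LIMSEQ nz tendsto_const) simp
  moreover have "((of_real (ln (real m)) - (\<Sum>n<m. inverse ((w + 1) / 2 + of_nat n))) -
             (of_real (ln (real m)) - (\<Sum>n<m. inverse (w / 2 + of_nat n)))) / 2 =
        (\<Sum>n<m. 1 / ((w + 2 * of_nat n) * (w + 2 * of_nat n + 1)))" for m
  proof -
    have "inverse (w / 2 + of_nat n) - inverse ((w + 1) / 2 + of_nat n) =
          2 * (1 / ((w + 2 * of_nat n) * (w + 2 * of_nat n + 1)))" for n
    proof -
      have 1: "w / 2 + of_nat n = (w + 2 * of_nat n) / 2"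
        and 2: "(w + 1) / 2 + of_nat n = (w + 2 * of_nat n + 1) / 2"
        by (simp_all add: field_simps)
      show ?thesis unfolding 1 2
        using plus_of_nat_neq_zero[OF w, of n] by (simp add: divide_simps)
    qed
    then have "(\<Sum>n<m. inverse (w / 2 + of_nat n)) - (\<Sum>n<m. inverse ((w + 1) / 2 + of_nat n)) =
        2 * (\<Sum>n<m. 1 / ((w + 2 * of_nat n) * (w + 2 * of_nat n + 1)))"
      by (simp only: sum_subtractf[symmetric] sum_distrib_left[symmetric])
    then show ?thesis by (simp add: field_simps)
  qed
  ultimately show ?thesis unfolding sums_def by simp
qed

lemma Re_pos_not_nonpos_Ints: "Re z > 0 \<Longrightarrow> z \<notin> \<int>\<^sub>\<le>\<^sub>0"
  by (auto elim!: nonpos_Ints_cases)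

lemma holomorphic_nielsen_beta [holomorphic_intros]:
  assumes "f holomorphic_on A" "\<And>z. z \<in> A \<Longrightarrow> Re (f z) > 0"
  shows "(\<lambda>z. nielsen_beta (f z)) holomorphic_on A"
proof -
  have "nielsen_beta holomorphic_on {w. Re w > 0}"
    unfolding nielsen_beta_def
    by (intro holomorphic_intros analytic_imp_holomorphic analytic_on_Polygamma' analytic_intros)
       (auto intro!: Re_pos_not_nonpos_Ints)
  then have "(nielsen_beta \<circ> f) holomorphic_on A"
    by (intro holomorphic_on_compose_gen[OF assms(1)]) (use assms(2) in auto)
  then show ?thesis by (simp add: o_def)
qed

section \<open>Bounds and asymptotics of \<open>nielsen_beta\<close> and
  \<open>gstar_num\<close>\<close>

lemma telescoping_reciprocals_sums:
  "(\<lambda>n. 1 / ((real n + 1) * (real n + 2))) sums 1"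
proof -
  have "(\<lambda>n. 1 / real (Suc n) - 1 / real (Suc (Suc n))) sums (1 / real (Suc 0) - 0)"
    by (rule telescope_sums') real_asymp
  also have "(\<lambda>n. 1 / real (Suc n) - 1 / real (Suc (Suc n))) = (\<lambda>n. 1 / ((real n + 1) * (real n + 2)))"
    by (auto simp: field_simps)
  finally show ?thesis by simp
qed

lemma nielsen_beta_norm_le:
  assumes "Re w \<ge> 1"
  shows "norm (nielsen_beta w) \<le> 1"
proof (rule norm_sums_le[OF nielsen_beta_sums telescoping_reciprocals_sums])
  show "Re w > 0" using assms by simp
  fix n :: nat
  have "real n + 1 \<le> Re (w + 2 * of_nat n)" "real n + 2 \<le> Re (w + 2 * of_nat n + 1)"
    using assms by simp_all
  then have "real n + 1 \<le> norm (w + 2 * of_nat n)" "real n + 2 \<le> norm (w + 2 * of_nat n + 1)"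
    using complex_Re_le_cmod order_trans by blast+
  then have "(real n + 1) * (real n + 2) \<le> norm (w + 2 * of_nat n) * norm (w + 2 * of_nat n + 1)"
    by (intro mult_mono) auto
  then show "norm (1 / ((w + 2 * of_nat n) * (w + 2 * of_nat n + 1))) \<le> 1 / ((real n + 1) * (real n + 2))"
    unfolding norm_divide norm_mult norm_one by (intro divide_left_mono mult_pos_pos) 
      (use plus_of_nat_neq_zero[of w n] assms in auto)
qed

text \<open>\<open>1 / (2 * w) + 1 / (4 * w\<^sup>2)\<close> solves the difference equation f w - f
  (w + 2) = 1 / (w (w + 1)) up to a term of order five. Summing along w, w + 2, w + 4, ... then
  shows it to be the start of the asymptotic expansion of \<open>nielsen_beta\<close>.\<close>

lemma telescope_remainder:
  fixes w :: complex
  assumes "w \<noteq> 0" "w + 1 \<noteq> 0" "w + 2 \<noteq> 0"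
  shows "(1 / (2 * w) + 1 / (4 * w\<^sup>2)) - (1 / (2 * (w + 2)) + 1 / (4 * (w + 2)\<^sup>2)) - 1 / (w * (w + 1))
       = 1 / (w\<^sup>2 * (w + 1) * (w + 2)\<^sup>2)"
  using assms by (simp add: divide_simps) algebra

lemma nielsen_beta_asymp:
  assumes w: "Re w > 0" "norm w \<ge> 1"
  shows "norm (nielsen_beta w - (1 / (2 * w) + 1 / (4 * w\<^sup>2))) \<le> 2 / norm w ^ 3"
proof -
  define u where "u n = w + 2 * of_nat n" for n :: nat
  define f where "f z = 1 / (2 * z) + 1 / (4 * z\<^sup>2)" for z :: complex
  have nz: "u n \<noteq> 0" "u n + 1 \<noteq> 0" "u n + 2 \<noteq> 0" for n
    using plus_of_nat_neq_zero[OF w(1), of n] by (simp_all add: u_def)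
  have lim: "filterlim u at_infinity sequentially"
    unfolding u_def
    by (intro tendsto_add_filterlim_at_infinity[OF tendsto_const]
              tendsto_mult_filterlim_at_infinity[OF tendsto_const] tendsto_of_nat) simp
  have "(\<lambda>n. f (u n)) \<longlonglongrightarrow> 0"
  proof -
    have "(\<lambda>n. (1/2) * inverse (u n) + (1/4) * (inverse (u n))^2) \<longlonglongrightarrow> (1/2) * 0 + (1/4) * 0^2"
      by (intro tendsto_intros filterlim_compose[OF tendsto_inverse_0 lim])
    then show ?thesis by (simp add: f_def field_simps)
  qed
  then have "(\<lambda>n. f (u n) - f (u (Suc n))) sums (f (u 0) - 0)"
    by (rule telescope_sums')
  moreover have "u (Suc n) = u n + 2" for n
    by (simp add: u_def)
  ultimately have "(\<lambda>n. f (u n) - f (u n + 2)) sums f w"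
    by (simp only:) (simp add: u_def)
  from sums_diff[OF this nielsen_beta_sums[OF w(1)]]
  have "(\<lambda>n. f (u n) - f (u n + 2) - 1 / (u n * (u n + 1))) sums (f w - nielsen_beta w)"
    by (simp add: u_def)
  then have S: "(\<lambda>n. 1 / ((u n)\<^sup>2 * (u n + 1) * (u n + 2)\<^sup>2)) sums (f w - nielsen_beta w)"
    unfolding f_def using telescope_remainder[OF nz] by simp
  have "norm (f w - nielsen_beta w) \<le> 2 / norm w ^ 3 * 1"
  proof (rule norm_sums_le[OF S sums_mult[OF telescoping_reciprocals_sums]])
    fix n :: nat
    have mono: "norm (z + of_nat m) \<ge> norm z \<and> norm (z + of_nat m) \<ge> real m" if "Re z > 0" for z :: complex and m
    proof
      have "(Re z)\<^sup>2 \<le> (Re z + real m)\<^sup>2" using that by (intro power_mono) auto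
      then show "norm (z + of_nat m) \<ge> norm z" by (simp add: norm_complex_def)
      have "real m \<le> Re (z + of_nat m)" using that by simp
      also have "\<dots> \<le> norm (z + of_nat m)" by (rule complex_Re_le_cmod)
      finally show "real m \<le> norm (z + of_nat m)" .
    qed
    \<comment> \<open>Of the five factors in the remainder, three are bounded below by
      \<open>norm w\<close>, which gives the cube; the two factors \<open>norm (u n + 2)\<close>
      supply the summable \<open>?r\<close>.\<close>
    let ?a = "norm w" and ?r = "(real n + 1) * (real n + 2)"
    have u1: "norm (u n) \<ge> ?a" using mono[OF w(1), of "2 * n"] by (simp add: u_def)
    have u2: "norm (u n + 1) \<ge> ?a" using mono[OF w(1), of "2 * n + 1"] by (simp add: u_def add_ac)
    have u3: "norm (u n + 1) \<ge> 1 + 2 * n" using mono[OF w(1), of "2 * n + 1"] by (simp add: u_def add_ac)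
    have u4: "norm (u n + 2) \<ge> ?a" "norm (u n + 2) \<ge> 2 * n + 2"
      using mono[OF w(1), of "2 * n + 2"] by (simp_all add: u_def add_ac)
    have u5: "norm (u n) ^ 2 * norm (u n + 1) \<ge> ?a ^ 3 " 
      using mult_mono[OF power_mono[OF u1, of 2] u2] by (simp add: power3_eq_cube power2_eq_square)
    have "real n + 1 \<le> norm (u n + 2)" "real n + 2 \<le> norm (u n + 2)" using u4 by linarith+
    then have "?r \<le> norm (u n + 2) ^ 2"
      unfolding power2_eq_square by (intro mult_mono) auto
    then have "?a ^ 3 * ?r \<le> norm (u n) ^ 2 * norm (u n + 1) * norm (u n + 2) ^ 2"
      by (intro mult_mono[OF u5]) auto
    moreover have "?a ^ 3 * ?r > 0" using w(2) by (intro mult_pos_pos zero_less_power) auto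
    ultimately have "1 / (norm (u n) ^ 2 * norm (u n + 1) * norm (u n + 2) ^ 2) \<le> 1 / (?a ^ 3 * ?r)"
      by (intro divide_left_mono mult_pos_pos) (auto simp: nz)
    also have "\<dots> \<le> 2 / (?a ^ 3 * ?r)"
      using \<open>?a ^ 3 * ?r > 0\<close> by (intro divide_right_mono) auto
    finally show "norm (1 / ((u n)\<^sup>2 * (u n + 1) * (u n + 2)\<^sup>2)) \<le> 2 / ?a ^ 3 * (1 / ?r)"
      by (simp add: norm_divide norm_mult norm_power)
  qed
  then show ?thesis by (simp add: f_def norm_minus_commute)
qed

text \<open>
  On \<open>Re q > - 2\<close> the only pole of \<open>gstar (- q)\<close> is \<open>q = - 1\<close>; \<open>gstar_num q\<close> is \<open>(q + 1) * gstar (- q)\<close>,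
  rewritten with two steps of the functional equation of \<open>nielsen_beta\<close> so that it is visibly
  holomorphic on this half plane.
\<close>

definition gstar_num :: "complex \<Rightarrow> complex" where
  "gstar_num q = 2 + 2 * q * (q + 1) * nielsen_beta (q + 2)"

lemma gstar_num_minus_one [simp]: "gstar_num (-1) = 2"
  by (simp add: gstar_num_def)

lemma holomorphic_gstar_num:
  assumes "f holomorphic_on A" "\<And>z. z \<in> A \<Longrightarrow> Re (f z) > -2"
  shows "(\<lambda>z. gstar_num (f z)) holomorphic_on A"
  unfolding gstar_num_def by (intro holomorphic_intros assms) (use assms(2) in force)

lemma gstar_eq_nielsen_beta: "q \<noteq> 0 \<Longrightarrow> gstar (- q) = 2 * q * nielsen_beta q"
  by (simp add: gstar_def nielsen_beta_def algebra_simps)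

lemma gstar_eq:
  assumes "q \<noteq> -1"
  shows "gstar (- q) = gstar_num q / (q + 1)"
proof (cases "q = 0")
  case False
  have nz: "q + 1 \<noteq> 0" using assms by (metis add_eq_0_iff2)
  have 1: "Digamma (q / 2 + 1) = Digamma (q / 2) + 2 * (1 / q)"
    using Digamma_plus1[of "q/2"] False by simp
  have 2: "Digamma ((q + 1) / 2 + 1) = Digamma ((q + 1) / 2) + 2 * (1 / (q + 1))"
    using Digamma_plus1[of "(q+1)/2"] nz by simp
  have 3: "(q + 2) / 2 = q / 2 + 1" "(q + 2 + 1) / 2 = (q + 1) / 2 + 1" by (simp_all add: field_simps)
  have 4: "((a + 2 * x) - (b + 2 * y)) / 2 = (a - b) / 2 + x - y" for a b x y :: complex
    by (simp add: field_simps)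
  have "nielsen_beta (q + 2) = nielsen_beta q + 1 / (q + 1) - 1 / q"
    unfolding nielsen_beta_def 3 1 2 by (rule 4)
  then have "gstar_num q = 2 * q * nielsen_beta q * (q + 1)"
    using nz False by (simp add: gstar_num_def divide_simps) algebra
  then show ?thesis using nz False by (simp add: gstar_eq_nielsen_beta)
qed (simp add: gstar_def gstar_num_def)

text \<open>Inserting the expansion of \<open>nielsen_beta\<close> at w = q + 2 leaves q + 3/2 + 1 /
  (2 w) + 1 / w^2 plus the scaled error. The three remaining terms contribute 1, 1 and 24 to the
  constant. The bound confines the zeros to a bounded set and yields the expansion of the
  resolvent.\<close>

lemma gstar_num_asymp:
  assumes "Re q > -2" "norm (q + 2) \<ge> 1"
  shows "norm (gstar_num q - (q + 3 / 2)) \<le> 26 / norm (q + 2)"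
proof -
  define w where "w = q + 2"
  define d where "d = nielsen_beta w - (1 / (2 * w) + 1 / (4 * w\<^sup>2))"
  have w: "Re w > 0" "norm w \<ge> 1" "w \<noteq> 0" using assms by (auto simp: w_def)
  have d: "norm d \<le> 2 / norm w ^ 3" unfolding d_def by (rule nielsen_beta_asymp) (use w in auto)
  have "nielsen_beta (q + 2) = d + (1 / (2 * w) + 1 / (4 * w\<^sup>2))" by (simp add: d_def w_def)
  moreover have "q = w - 2" by (simp add: w_def)
  ultimately have "gstar_num q - (q + 3 / 2) = 1 / (2 * w) + 1 / w\<^sup>2 + 2 * (w - 2) * (w - 1) * d"
    using w(3) by (simp add: gstar_num_def divide_simps) algebra
  also have "norm \<dots> \<le> norm (1 / (2 * w)) + norm (1 / w\<^sup>2) + norm (2 * (w - 2) * (w - 1) * d)"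
    by (meson norm_triangle_ineq norm_triangle_le add_mono order_refl)
  also have "norm (1 / w\<^sup>2) \<le> 1 / norm w"
    using w by (simp add: norm_divide norm_mult divide_simps power2_eq_square)
  also have "norm (1 / (2 * w)) \<le> 1 / norm w"
    using w by (simp add: norm_divide norm_mult divide_simps)
  also have "norm (2 * (w - 2) * (w - 1) * d) \<le> 2 * (3 * norm w) * (2 * norm w) * (2 / norm w ^ 3)"
    unfolding norm_mult
  proof (intro mult_mono d)
    have "norm (w - 2) \<le> norm w + 2" using norm_triangle_ineq4[of w 2] by simp
    then show "norm (w - 2) \<le> 3 * norm w" using w by simp
    have "norm (w - 1) \<le> norm w + 1" using norm_triangle_ineq4[of w 1] by simp
    then show "norm (w - 1) \<le> 2 * norm w" using w by simp
  qed (use w in auto)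
  also have "2 * (3 * norm w) * (2 * norm w) * (2 / norm w ^ 3) = 24 / norm w"
    using w by (simp add: power3_eq_cube field_simps)
  finally show ?thesis using w by (simp add: w_def)
qed

text \<open>The delicate point is z = 1. There \<open>gstar_num\<close> has the value 2, so
  \<open>gstar\<close> has a genuine pole and the point is excluded by the pole clause, whatever
  value the total function takes.\<close>

lemma gstar_zeros_iff:
  assumes "Re z < 2"
  shows "z \<in> gstar_zeros \<longleftrightarrow> gstar_num (- z) = 0"
proof (cases "z = 1")
  case True
  have cont: "isCont (\<lambda>z. gstar_num (- z)) z" if "Re z < 2" for z
  proof -
    have "(\<lambda>z. gstar_num (- z)) holomorphic_on {z. Re z < 2}"
      by (intro holomorphic_gstar_num holomorphic_intros) auto
    then show ?thesis using that
      by (intro continuous_on_interior[OF holomorphic_on_imp_continuous_on])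
         (auto simp: interior_open open_halfspace_Re_lt)
  qed
  have "is_pole (\<lambda>z. gstar_num (- z) / (1 - z)) 1"
  proof (rule is_pole_divide)
    show "isCont (\<lambda>z. gstar_num (- z)) 1" by (rule cont) simp
    show "filterlim (\<lambda>z::complex. 1 - z) (at 0) (at 1)"
      unfolding filterlim_at by (auto intro!: tendsto_eq_intros simp: eventually_at_filter)
  qed auto
  moreover have "eventually (\<lambda>z. gstar_num (- z) / (1 - z) = gstar z) (at 1)"
  proof -
    have "gstar_num (- z) / (1 - z) = gstar z" if "z \<noteq> 1" for z
      using gstar_eq[of "- z"] that by auto
    then show ?thesis by (auto simp: eventually_at_filter)
  qed
  ultimately have "is_pole gstar 1"
    by (rule iffD1[OF is_pole_cong[OF _ refl], rotated])
  then show ?thesis using True by (auto simp: gstar_zeros_def)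
next
  case False
  have "gstar holomorphic_on {z. Re z < 2} - {1}"
  proof (rule holomorphic_transform)
    show "(\<lambda>z. gstar_num (- z) / (1 - z)) holomorphic_on {z. Re z < 2} - {1}"
      by (intro holomorphic_intros holomorphic_gstar_num) auto
    show "gstar_num (- z) / (1 - z) = gstar z" if "z \<in> {z. Re z < 2} - {1}" for z
      using gstar_eq[of "- z"] that by auto
  qed
  then have "\<not> is_pole gstar z"
    using assms False
    by (intro not_is_pole_holomorphic[of "{z. Re z < 2} - {1}"]) (auto intro: open_halfspace_Re_lt)
  moreover have "gstar z = gstar_num (- z) / (1 - z)"
    using gstar_eq[of "- z"] False by auto
  ultimately show ?thesis using False by (auto simp: gstar_zeros_def)
qed

section \<open>Existence of zeros with real part below 2\<close>

text \<open>Logarithmic differentiation of the reflection formula for the reciprocal Gamma function.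
  The sine stays as a factor so that no quotient has to be formed.\<close>

lemma Digamma_reflection:
  fixes z :: complex
  assumes "z \<notin> \<int>"
  shows "sin (of_real pi * z) * (Digamma (1 - z) - Digamma z) = of_real pi * cos (of_real pi * z)"
proof -
  have z: "z \<notin> \<int>\<^sub>\<le>\<^sub>0" "1 - z \<notin> \<int>\<^sub>\<le>\<^sub>0"
    using assms by (auto dest!: nonpos_Ints_Int simp: minus_in_Ints_iff)
  have "((\<lambda>z. rGamma z * rGamma (1 - z)) has_field_derivative
         rGamma z * rGamma (1 - z) * (Digamma (1 - z) - Digamma z)) (at z)"
    using z by (auto intro!: derivative_eq_intros simp: algebra_simps)
  moreover have "((\<lambda>z. rGamma z * rGamma (1 - z)) has_field_derivative cos (of_real pi * z)) (at z)"
    unfolding rGamma_reflection_complex by (auto intro!: derivative_eq_intros)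
  ultimately have "rGamma z * rGamma (1 - z) * (Digamma (1 - z) - Digamma z) = cos (of_real pi * z)"
    by (rule DERIV_unique)
  then show ?thesis unfolding rGamma_reflection_complex by (simp add: field_simps)
qed

text \<open>This is \<open>gstar z * sin (of_real pi * z) / (2 * z)\<close> after reflection. The
  sine cancels the poles, and \<open>nielsen_beta\<close> is evaluated where its series converges,
  so the function is visibly holomorphic on Re z > -1.\<close>

definition gstar_sin :: "complex \<Rightarrow> complex" where
  "gstar_sin z = of_real pi + sin (of_real pi * z) * nielsen_beta (z + 1)"

lemma half_in_Ints_imp: "(z::complex) / 2 \<in> \<int> \<Longrightarrow> z \<in> \<int>"
  using Ints_mult[of "z/2" 2] by simp

text \<open>Reflection moves -z/2 to 1 + z/2 and (1 - z)/2 to (1 + z)/2. It costs a cotangent and a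
  tangent of a = \<pi> z / 2, which combine through sin^2 + cos^2 = 1 once multiplied by sin (2
  a).\<close>

lemma gstar_eq_gstar_sin:
  assumes "z \<notin> \<int>"
  shows "gstar z * sin (of_real pi * z) = 2 * z * gstar_sin z"
proof -
  define a where "a = of_real pi * z / 2"
  have "z \<noteq> 0" using assms by auto
  have n1: "1 + z / 2 \<notin> \<int>"
    using assms half_in_Ints_imp[of z] Ints_diff[of "1 + z / 2" 1] by auto
  have n2: "(1 + z) / 2 \<notin> \<int>"
    using assms half_in_Ints_imp[of "1 + z"] Ints_diff[of "1 + z" 1] by auto
  have e1: "of_real pi * (1 + z / 2) = of_real pi + a" "1 - (1 + z / 2) = - z / 2"
    and e2: "of_real pi * ((1 + z) / 2) = a + of_real pi / 2" "1 - (1 + z) / 2 = (1 - z) / 2"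
    and e3: "of_real pi * z = 2 * a"
    by (simp_all add: a_def field_simps)
  have r1: "sin a * (Digamma (- z / 2) - Digamma (1 + z / 2)) = of_real pi * cos a"
    using Digamma_reflection[OF n1] unfolding e1 by (simp add: sin_add cos_add)
  have sc: "sin (a + of_real pi / 2) = cos a" "cos (a + of_real pi / 2) = - sin a"
    by (simp_all add: sin_add cos_add flip: of_real_divide sin_of_real cos_of_real)
  have r2: "cos a * (Digamma ((1 - z) / 2) - Digamma ((1 + z) / 2)) = - of_real pi * sin a"
    using Digamma_reflection[OF n2] unfolding e2 sc by simp
  have h: "(z + 1 + 1) / 2 = 1 + z / 2" "(z + 1) / 2 = (1 + z) / 2" by (simp_all add: field_simps)
  have b: "nielsen_beta (z + 1) = (Digamma (1 + z / 2) - Digamma ((1 + z) / 2)) / 2"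
    unfolding nielsen_beta_def h ..
  have "(Digamma (- z / 2) - Digamma ((1 - z) / 2)) * (2 * sin a * cos a) =
     2 * cos a * (sin a * (Digamma (- z / 2) - Digamma (1 + z / 2)))
     - 2 * sin a * (cos a * (Digamma ((1 - z) / 2) - Digamma ((1 + z) / 2)))
     + 2 * sin a * cos a * (Digamma (1 + z / 2) - Digamma ((1 + z) / 2))"
    by (simp add: algebra_simps)
  also have "\<dots> = 2 * of_real pi * ((sin a)\<^sup>2 + (cos a)\<^sup>2) +
      2 * sin a * cos a * (Digamma (1 + z / 2) - Digamma ((1 + z) / 2))"
    unfolding r1 r2 by algebra
  also have "\<dots> = 2 * gstar_sin z"
    unfolding gstar_sin_def b e3 sin_double sin_cos_squared_add by (simp add: field_simps)
  finally show ?thesis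
    using \<open>z \<noteq> 0\<close> unfolding gstar_def e3 sin_double by (simp add: algebra_simps)
qed

text \<open>In the upper half plane every term of the series has nonpositive imaginary part, so the
  term n = 0 alone is an upper bound.\<close>

lemma Im_nielsen_beta_le:
  assumes "Re w > 0" "Im w \<ge> 0"
  shows "Im (nielsen_beta w) \<le> - (Im w * (2 * Re w + 1) / (norm w * norm (w + 1))\<^sup>2)"
proof -
  define t where "t n = - Im (1 / ((w + 2 * of_nat n) * (w + 2 * of_nat n + 1)))" for n :: nat
  have t: "t n = Im w * (2 * (Re w + 2 * real n) + 1) / (norm (w + 2 * of_nat n) * norm (w + 2 * of_nat n + 1))\<^sup>2" for n
  proof -
    have "Im (1 / p) = - Im p / (norm p)\<^sup>2" for p
      by (simp add: Im_divide cmod_power2)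
    then show ?thesis unfolding t_def norm_mult[symmetric] by (simp add: algebra_simps)
  qed
  have "t sums (- Im (nielsen_beta w))"
    unfolding t_def by (intro sums_minus sums_Im nielsen_beta_sums assms)
  moreover have "t n \<ge> 0" for n
    unfolding t using assms by (intro divide_nonneg_nonneg mult_nonneg_nonneg) auto
  ultimately have "sum t {0} \<le> - Im (nielsen_beta w)"
    by (metis finite.emptyI finite.insertI sum_le_suminf sums_iff)
  then show ?thesis by (simp add: t)
qed

text \<open>Here M is a continuous argument of a function with positive real part. If it varied by
  \<pi> or more, it would attain M a + \<pi>, where the cosine is - cos (M a) and hence
  negative.\<close>

lemma connected_cos_pos_imp_variation_less_pi:
  fixes M :: "'a::topological_space \<Rightarrow> real"
  assumes T: "connected T" "continuous_on T M" and pos: "\<And>t. t \<in> T \<Longrightarrow> cos (M t) > 0"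
    and ab: "a \<in> T" "b \<in> T"
  shows "\<bar>M a - M b\<bar> < pi"
proof -
  have *: "M b < M a + pi" if "a \<in> T" "b \<in> T" for a b
  proof (rule ccontr)
    assume "\<not> M b < M a + pi"
    then have "M a + pi \<in> {M a..M b}" by simp
    moreover have "connected (M ` T)" by (rule connected_continuous_image[OF T(2,1)])
    ultimately have "M a + pi \<in> M ` T"
      using that by (meson connected_contains_Icc imageI subsetD)
    then obtain c where "c \<in> T" "M c = M a + pi" by auto
    then show False using pos[of c] pos[OF that(1)] by simp
  qed
  from *[OF ab] *[OF ab(2,1)] show ?thesis by linarith
qed

text \<open>On these two vertical lines sin (\<pi> z) equals \<i> sinh (\<pi> Im z), so the real
  part of the product is - sinh (\<pi> Im z) times the nonpositive imaginary part of
  \<open>nielsen_beta\<close>.\<close>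

lemma Re_gstar_sin_pos:
  assumes "Re z = 0 \<or> Re z = 2" "Im z \<ge> 0"
  shows "Re (gstar_sin z) > 0"
proof -
  have "Im (nielsen_beta (z + 1)) \<le> - (Im (z + 1) * (2 * Re (z + 1) + 1) / (norm (z + 1) * norm (z + 1 + 1))\<^sup>2)"
    by (rule Im_nielsen_beta_le) (use assms in auto)
  also have "\<dots> \<le> 0"
    using assms by (auto intro!: divide_nonneg_nonneg mult_nonneg_nonneg)
  finally have B: "Im (nielsen_beta (z + 1)) \<le> 0" .
  have "Re (sin (of_real pi * z)) = 0" "Im (sin (of_real pi * z)) \<ge> 0"
    using assms by (auto simp: Re_sin Im_sin mult.commute[of pi])
  then have "Re (sin (of_real pi * z) * nielsen_beta (z + 1)) \<ge> 0"
    using B by (simp add: mult_nonneg_nonpos)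
  then show ?thesis unfolding gstar_sin_def by (simp del: times_complex.sel add: add_pos_nonneg)
qed

text \<open>On the real segment both factors of the product have norm at most 1, which the summand
  \<pi> outweighs.\<close>

lemma Re_gstar_sin_pos_real:
  assumes "Re z \<in> {0..2}" "Im z = 0"
  shows "Re (gstar_sin z) > 0"
proof -
  have s: "sin (of_real pi * z) = of_real (sin (pi * Re z))"
    using assms(2) by (metis complex_is_Real_iff of_real_Re of_real_mult sin_of_real)
  have "norm (sin (of_real pi * z) * nielsen_beta (z + 1)) \<le> 1 * 1"
    unfolding norm_mult s using assms by (intro mult_mono nielsen_beta_norm_le) auto
  then have "\<bar>Re (sin (of_real pi * z) * nielsen_beta (z + 1))\<bar> \<le> 1"
    using abs_Re_le_cmod order_trans by fastforce
  then show ?thesis unfolding gstar_sin_def using pi_gt3 by (simp del: times_complex.sel)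
qed

text \<open>With e = exp (\<i> \<pi> z) one has sin (\<pi> z) e = \<i> / 2 (1 - e^2), and e is
  exponentially small high up. The main term \<i> / 2 \<open>nielsen_beta (z + 1)\<close> has real
  part - Im / 2, which is positive and decays only like Y^(-3), so it dominates.\<close>

lemma Re_gstar_sin_exp_pos:
  obtains Y where "Y > 0" "\<And>z. Re z \<in> {0..2} \<Longrightarrow> Im z = Y \<Longrightarrow> Re (gstar_sin z * exp (\<i> * of_real pi * z)) > 0"
proof -
  \<comment> \<open>The rational function is the lower bound that \<open>Im_nielsen_beta_le\<close>
    gives at z + 1 for Re z between 0 and 2: there 2 Re (z + 1) + 1 \<ge> 3, |z + 1|^2 \<le> 9 + Y^2
    and |z + 2|^2 \<le> 16 + Y^2.\<close>
  have "\<forall>\<^sub>F Y in at_top. (pi + 1) * exp (- pi * Y) < (3 * Y / ((9 + Y\<^sup>2) * (16 + Y\<^sup>2))) / 2 \<and> Y > 0"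
    by (intro eventually_conj) (real_asymp, real_asymp)
  then obtain Y where Y: "(pi + 1) * exp (- pi * Y) < (3 * Y / ((9 + Y\<^sup>2) * (16 + Y\<^sup>2))) / 2" "Y > 0"
    by (metis (no_types, lifting) eventually_happens trivial_limit_at_top_linorder)
  show ?thesis
  proof (rule that[OF Y(2)])
    fix z assume z: "Re z \<in> {0..2}" "Im z = Y"
    define e where "e = exp (\<i> * of_real pi * z)"
    define B where "B = nielsen_beta (z + 1)"
    have ne: "norm e = exp (- pi * Y)" using z by (simp add: e_def)
    have ne1: "norm e \<le> 1" unfolding ne using Y by simp
    have "norm (z + 1) ^ 2 \<le> 9 + Y\<^sup>2" "norm (z + 2) ^ 2 \<le> 16 + Y\<^sup>2"
      using z power_mono[of "Re z + 1" 3 2] power_mono[of "Re z + 2" 4 2] by (auto simp: cmod_power2)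
    then have d: "(norm (z + 1) * norm (z + 1 + 1))\<^sup>2 \<le> (9 + Y\<^sup>2) * (16 + Y\<^sup>2)"
      unfolding power_mult_distrib by (intro mult_mono) (auto simp: add.assoc)
    have pos: "(norm (z + 1) * norm (z + 1 + 1))\<^sup>2 > 0"
      using z by (auto simp: complex_eq_iff)
    have "3 * Y / ((9 + Y\<^sup>2) * (16 + Y\<^sup>2)) \<le> Im (z + 1) * (2 * Re (z + 1) + 1) / (norm (z + 1) * norm (z + 1 + 1))\<^sup>2"
      by (intro frac_le d pos) (use z Y in auto)
    moreover have "Im B \<le> - (Im (z + 1) * (2 * Re (z + 1) + 1) / (norm (z + 1) * norm (z + 1 + 1))\<^sup>2)"
      unfolding B_def by (rule Im_nielsen_beta_le) (use z Y in auto)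
    ultimately have B: "Im B \<le> - (3 * Y / ((9 + Y\<^sup>2) * (16 + Y\<^sup>2)))" by linarith
    have B1: "norm B \<le> 1" unfolding B_def by (rule nielsen_beta_norm_le) (use z in auto)
    have "sin (of_real pi * z) * e = \<i> / 2 * (1 - e * e)"
      unfolding e_def sin_exp_eq by (simp add: field_simps exp_minus)
    then have "gstar_sin z * e = of_real pi * e + (\<i> / 2 * (1 - e * e)) * B"
      unfolding gstar_sin_def B_def[symmetric] by (metis (no_types, lifting) distrib_right mult.assoc mult.commute)
    also have "\<dots> = of_real pi * e + \<i> / 2 * B - \<i> / 2 * (e * e * B)"
      by (simp add: field_simps)
    finally have "gstar_sin z * e = of_real pi * e + \<i> / 2 * B - \<i> / 2 * (e * e * B)" .
    then have eq: "Re (gstar_sin z * e) = Re (of_real pi * e - \<i> / 2 * (e * e * B)) - Im B / 2"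
      by simp
    have "norm (of_real pi * e - \<i> / 2 * (e * e * B)) \<le> norm (of_real pi * e) + norm (\<i> / 2 * (e * e * B))"
      by (rule norm_triangle_ineq4)
    also have "\<dots> = pi * norm e + norm e * (norm e * norm B) / 2"
      by (simp add: norm_mult)
    also have "norm e * (norm e * norm B) \<le> norm e * (1 * 1)"
      by (intro mult_mono B1 ne1) auto
    also have "pi * norm e + norm e * (1 * 1) / 2 \<le> (pi + 1) * norm e"
      by (simp add: algebra_simps)
    finally have "norm (of_real pi * e - \<i> / 2 * (e * e * B)) \<le> (pi + 1) * exp (- pi * Y)"
      unfolding ne by simp
    then have "\<bar>Re (of_real pi * e - \<i> / 2 * (e * e * B))\<bar> \<le> (pi + 1) * exp (- pi * Y)"
      using abs_Re_le_cmod order_trans by blast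
    moreover have "0 < r - b / 2" if "\<bar>r\<bar> \<le> a" "b \<le> - t" "a < t / 2" for r a b t :: real
      using that by linarith
    ultimately show "Re (gstar_sin z * exp (\<i> * of_real pi * z)) > 0"
      unfolding e_def[symmetric] eq using B Y(1) by blast
  qed
qed

text \<open>
  Otherwise \<open>gstar_sin\<close> has a continuous logarithm on the half strip. Its argument varies by less
  than \<open>\<pi>\<close> along the left, bottom and right edges, where the real part is positive, but by about
  \<open>2\<pi>\<close> along a high horizontal segment, where \<open>gstar_sin z\<close> behaves like \<open>exp (- \<i> \<pi> z)\<close>.
\<close>

lemma gstar_sin_zero_exists:
  obtains z where "0 < Re z" "Re z < 2" "gstar_sin z = 0"
proof -
  define S where "S = {z. 0 \<le> Re z \<and> Re z \<le> 2 \<and> 0 \<le> Im z}"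
  have S: "S = {z. Re z \<ge> 0} \<inter> {z. Re z \<le> 2} \<inter> {z. Im z \<ge> 0}"
    by (auto simp: S_def)
  have conv: "convex S"
    unfolding S by (intro convex_Int convex_halfspace_Re_ge convex_halfspace_Re_le convex_halfspace_Im_ge)
  have cont: "continuous_on S gstar_sin"
    unfolding gstar_sin_def
    by (intro holomorphic_on_imp_continuous_on holomorphic_intros) (auto simp: S_def)
  have "\<exists>z\<in>S. gstar_sin z = 0"
  proof (rule ccontr)
    assume "\<not> ?thesis"
    then obtain L where L: "continuous_on S L" "\<And>z. z \<in> S \<Longrightarrow> gstar_sin z = exp (L z)"
      using continuous_logarithm_on_contractible[OF cont convex_imp_contractible[OF conv]] by metis
    obtain Y where Y: "Y > 0" "\<And>z. Re z \<in> {0..2} \<Longrightarrow> Im z = Y \<Longrightarrow> Re (gstar_sin z * exp (\<i> * of_real pi * z)) > 0"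
      using Re_gstar_sin_exp_pos by blast
    let ?a = "Complex 0 Y" and ?b = "Complex 2 Y"
    define A1 A2 A3 where "A1 = {z. Re z \<ge> 0} \<inter> {z. Re z \<le> 0} \<inter> {z. Im z \<ge> 0}"
      and "A2 = {z. Im z \<ge> 0} \<inter> {z. Im z \<le> 0} \<inter> ({z. Re z \<ge> 0} \<inter> {z. Re z \<le> 2})"
      and "A3 = {z. Re z \<ge> 2} \<inter> {z. Re z \<le> 2} \<inter> {z. Im z \<ge> 0}"
    define H where "H = {z. Im z \<ge> Y} \<inter> {z. Im z \<le> Y} \<inter> ({z. Re z \<ge> 0} \<inter> {z. Re z \<le> 2})"
    have cvx: "convex A1" "convex A2" "convex A3" "convex H"
      unfolding A1_def A2_def A3_def H_def
      by (intro convex_Int convex_halfspace_Re_ge convex_halfspace_Re_le convex_halfspace_Im_ge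
          convex_halfspace_Im_le)+
    have "0 \<in> A1 \<inter> A2" "2 \<in> (A1 \<union> A2) \<inter> A3"
      by (auto simp: A1_def A2_def A3_def)
    then have "connected (A1 \<union> A2 \<union> A3)"
      by (intro connected_Un convex_connected cvx) blast+
    moreover have sub: "A1 \<union> A2 \<union> A3 \<subseteq> S" "H \<subseteq> S"
      using Y by (auto simp: A1_def A2_def A3_def H_def S_def)
    moreover have "cos (Im (L z)) > 0" if "z \<in> A1 \<union> A2 \<union> A3" for z
    proof -
      have "Re (gstar_sin z) > 0"
        using that Re_gstar_sin_pos[of z] Re_gstar_sin_pos_real[of z]
        by (auto simp: A1_def A2_def A3_def)
      then show ?thesis using L(2)[of z] sub that by (auto simp: Re_exp zero_less_mult_iff)
    qed
    ultimately have "\<bar>Im (L ?a) - Im (L ?b)\<bar> < pi"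
      using Y by (intro connected_cos_pos_imp_variation_less_pi[of "A1 \<union> A2 \<union> A3" "\<lambda>z. Im (L z)"]
          continuous_intros continuous_on_subset[OF L(1)]) (auto simp: A1_def A3_def)
    \<comment> \<open>Multiplication by exp (\<i> \<pi> z) adds \<open>pi * Re z\<close> to the
      argument. Between \<open>?a\<close> and \<open>?b\<close> this amounts to 2 \<pi>, so the two
      variations cannot both be less than \<pi>.\<close>
    moreover have "\<bar>(Im (L ?a) + pi * Re ?a) - (Im (L ?b) + pi * Re ?b)\<bar> < pi"
    proof (rule connected_cos_pos_imp_variation_less_pi[of H "\<lambda>z. Im (L z) + pi * Re z"])
      fix z assume z: "z \<in> H"
      have "Re (exp (L z + \<i> * of_real pi * z)) > 0"
        using Y(2)[of z] z L(2)[of z] sub by (auto simp: exp_add H_def)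
      then show "cos (Im (L z) + pi * Re z) > 0"
        by (auto simp: Re_exp zero_less_mult_iff)
    qed (use Y in \<open>auto intro!: continuous_intros convex_connected[OF cvx(4)] continuous_on_subset[OF L(1) sub(2)]\<close>, auto simp: H_def)
    ultimately show False by simp
  qed
  then obtain z where z: "z \<in> S" "gstar_sin z = 0" by auto
  have "Re z \<noteq> 0" "Re z \<noteq> 2" using Re_gstar_sin_pos[of z] z by (auto simp: S_def)
  then show ?thesis using that[of z] z by (auto simp: S_def)
qed

text \<open>A zero of \<open>gstar_sin\<close> is never an integer, since the sine vanishes at
  integers and leaves the value \<pi>. Hence the reflected identity applies to it and the pole at 1
  is avoided.\<close>

lemma gstar_num_zero_exists:
  obtains z where "0 < Re z" "Re z < 2" "gstar_num (- z) = 0"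
proof -
  obtain z where z: "0 < Re z" "Re z < 2" "gstar_sin z = 0" by (rule gstar_sin_zero_exists)
  have "z \<notin> \<int>"
  proof
    assume "z \<in> \<int>"
    then obtain n where n: "z = of_int n" by (auto elim: Ints_cases)
    have "sin (of_real pi * z) = of_real (sin (pi * of_int n))"
      unfolding n by (metis of_real_mult of_real_of_int_eq sin_of_real)
    also have "\<dots> = 0" by (simp add: sin_zero_iff_int2 mult.commute)
    finally show False using z(3) by (simp add: gstar_sin_def)
  qed
  have "sin (of_real pi * z) \<noteq> 0"
    using z(3) by (auto simp: gstar_sin_def)
  then have "gstar z = 0"
    using gstar_eq_gstar_sin[OF \<open>z \<notin> \<int>\<close>] z(3) by simp
  moreover have "z \<noteq> 1" using \<open>z \<notin> \<int>\<close> by auto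
  ultimately have "gstar_num (- z) = 0"
    using gstar_eq[of "- z"] by auto
  then show ?thesis using that z by blast
qed

text \<open>\<open>LEAST\<close> over the reals carries information only if the minimum is attained.
  Under q = - z, the zeros at least as far left as one known zero z0 form a compact set: closed by
  continuity, bounded because \<open>gstar_num q\<close> is close to q + 3/2. The real part attains
  its extremum there.\<close>

lemma alpha1_is_least:
  shows alpha1_less_2: "alpha1 < 2"
    and gstar_num_nonzero: "Re q > - alpha1 \<Longrightarrow> gstar_num q \<noteq> 0"
proof -
  obtain z0 where z0: "0 < Re z0" "Re z0 < 2" "gstar_num (- z0) = 0"
    by (rule gstar_num_zero_exists)
  define H where "H = {q. Re q \<ge> - Re z0}"
  define Z where "Z = H \<inter> gstar_num -` {0}"
  have H2: "Re q > -2" if "q \<in> H" for q using that z0 by (simp add: H_def)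
  have "continuous_on H gstar_num"
    by (intro holomorphic_on_imp_continuous_on holomorphic_gstar_num holomorphic_on_ident H2)
  then have "closed Z"
    unfolding Z_def by (rule continuous_closed_preimage) (auto simp: H_def closed_halfspace_Re_ge)
  moreover have "bounded Z"
  proof (rule boundedI)
    fix q assume q: "q \<in> Z"
    \<comment> \<open>Beyond this radius the error of the approximation by q + 3/2 is at most 26, so
      a zero would satisfy |q + 3/2| \<le> 26 and |q + 2| \<le> 26.5.\<close>
    have "norm (q + 2) \<le> 28"
    proof (rule ccontr)
      assume "\<not> norm (q + 2) \<le> 28"
      then have l: "norm (q + 2) > 28" by simp
      have "norm (gstar_num q - (q + 3 / 2)) \<le> 26 / norm (q + 2)"
        by (rule gstar_num_asymp) (use H2 q l in \<open>auto simp: Z_def\<close>)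
      also have "\<dots> \<le> 26" using l by (simp add: divide_simps)
      finally have "norm (q + 3 / 2) \<le> 26" using q norm_minus_cancel[of "q + 3 / 2"] by (simp add: Z_def del: norm_minus_cancel)
      moreover have "norm (q + 2) \<le> norm (q + 3 / 2) + norm (1 / 2 :: complex)"
        using norm_triangle_ineq[of "q + 3 / 2" "1 / 2"] by (simp add: add.assoc)
      ultimately show False using l by simp
    qed
    moreover have "norm q \<le> norm (q + 2) + norm (2 :: complex)"
      using norm_triangle_ineq4[of "q + 2" 2] by simp
    ultimately show "norm q \<le> 30" by simp
  qed
  ultimately have "compact Z" by (simp add: compact_eq_bounded_closed)
  moreover have "- z0 \<in> Z" using z0 by (simp add: Z_def H_def)
  ultimately obtain p where p: "p \<in> Z" "\<And>q. q \<in> Z \<Longrightarrow> Re q \<le> Re p"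
    using continuous_attains_sup[of Z Re] continuous_on_Re[OF continuous_on_id] by auto
  have pz: "Re (- p) \<le> Re z0" using p(2)[OF \<open>- z0 \<in> Z\<close>] by simp
  have "alpha1 = Re (- p)"
    unfolding alpha1_def
  proof (rule Least_equality)
    have "- p \<in> gstar_zeros" using p pz z0 by (subst gstar_zeros_iff) (auto simp: Z_def)
    then show "Re (- p) \<in> Re ` gstar_zeros" by (rule imageI)
  next
    fix x assume "x \<in> Re ` gstar_zeros"
    then obtain z where z: "z \<in> gstar_zeros" "x = Re z" by auto
    show "Re (- p) \<le> x"
    proof (cases "Re z \<le> Re z0")
      case True
      then have "- z \<in> Z" using z z0 gstar_zeros_iff[of z] by (auto simp: Z_def H_def)
      from p(2)[OF this] show ?thesis using z by simp
    next
      case False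
      then show ?thesis using pz z by simp
    qed
  qed
  then show "alpha1 < 2" using pz z0 by simp
  assume "Re q > - alpha1"
  then show "gstar_num q \<noteq> 0"
    using \<open>alpha1 = Re (- p)\<close> p(2)[of q] pz by (auto simp: Z_def H_def)
qed

section \<open>Fourier inversion, contour shifts and convolutions\<close>

lemma measurable_iexp [measurable]: "iexp \<in> borel_measurable borel"
  by (intro borel_measurable_continuous_onI continuous_intros)

lemma integrable_times_bounded:
  fixes f :: "'a \<Rightarrow> complex" and h :: "'a \<Rightarrow> complex"
  assumes "integrable M f" "h \<in> borel_measurable M" "\<And>x. norm (h x) \<le> B"
  shows "integrable M (\<lambda>x. f x * h x)"
proof (rule Bochner_Integration.integrable_bound)
  show "integrable M (\<lambda>x. of_real B * f x)" using assms(1) by simp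
  show "AE x in M. norm (f x * h x) \<le> norm (of_real B * f x)"
  proof (intro AE_I2)
    fix x
    have "norm (h x) \<le> \<bar>B\<bar>" using assms(3)[of x] by simp
    then have "norm (f x) * norm (h x) \<le> norm (f x) * \<bar>B\<bar>" by (intro mult_left_mono) auto
    then show "norm (f x * h x) \<le> norm (of_real B * f x)"
      by (simp add: norm_mult mult.commute)
  qed
qed (use assms in measurable)

lemma integrable_pair_product:
  fixes f g :: "real \<Rightarrow> complex"
  assumes f: "integrable lborel f" and g: "integrable lborel g"
  shows "integrable (lborel \<Otimes>\<^sub>M lborel) (\<lambda>(x, y). f x * g y)"
proof (rule lborel_pair.Fubini_integrable)
  have [measurable]: "f \<in> borel_measurable borel" "g \<in> borel_measurable borel"
    using f g by auto
  show "(\<lambda>(x, y). f x * g y) \<in> borel_measurable (lborel \<Otimes>\<^sub>M lborel)" by measurable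
  show "integrable lborel (\<lambda>x. LINT y|lborel. norm (case (x, y) of (x, y) \<Rightarrow> f x * g y))"
    using f by (simp add: norm_mult)
  show "AE x in lborel. integrable lborel (\<lambda>y. case (x, y) of (x, y) \<Rightarrow> f x * g y)"
    using g by simp
qed

section \<open>Fourier inversion by Gaussian regularization\<close>

definition fourier :: "(real \<Rightarrow> complex) \<Rightarrow> real \<Rightarrow> complex" where
  "fourier f y = (LINT x|lborel. f x * iexp (- (y * x)))"

lemma measurable_fourier [measurable]:
  assumes [measurable]: "f \<in> borel_measurable borel"
  shows "fourier f \<in> borel_measurable borel"
  unfolding fourier_def by measurable

lemma std_normal_scaled_integral:
  fixes t :: real
  assumes e: "e > 0"
  shows "(LINT y|lborel. of_real (std_normal_density (e * y)) * iexp (t * y)) =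
           of_real (sqrt (2 * pi) / e * std_normal_density (t / e))"
    and "integrable lborel (\<lambda>y. complex_of_real (std_normal_density (e * y)))"
proof -
  have "complex_of_real (exp (- ((t / e)\<^sup>2) / 2)) = (LINT u|lborel. of_real (std_normal_density u) * iexp (t / e * u))"
    using fun_cong[OF char_std_normal_distribution, of "t / e"]
    unfolding char_def by (subst (asm) integral_density) (auto simp: scaleR_conv_of_real)
  also have "\<dots> = \<bar>e\<bar> *\<^sub>R (LINT y|lborel. of_real (std_normal_density (0 + e * y)) * iexp (t / e * (0 + e * y)))"
    by (rule lborel_integral_real_affine) (use e in auto)
  finally have "complex_of_real (exp (- ((t / e)\<^sup>2) / 2)) =
      e * (LINT y|lborel. of_real (std_normal_density (e * y)) * iexp (t * y))"
    using e by (simp add: scaleR_conv_of_real)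
  then show "(LINT y|lborel. of_real (std_normal_density (e * y)) * iexp (t * y)) =
           of_real (sqrt (2 * pi) / e * std_normal_density (t / e))"
    using e by (simp add: std_normal_density_def field_simps)
  have "integrable lborel (\<lambda>u. complex_of_real (std_normal_density u))"
    using integrable_std_normal_moment[of 0] by simp
  from lborel_integrable_real_affine[OF this, of e 0] e
  show "integrable lborel (\<lambda>y. complex_of_real (std_normal_density (e * y)))" by simp
qed

text \<open>A Gaussian factor of width 1 / \<open>e n\<close> makes the double integral absolutely
  convergent. After Fubini the inner integral is again a Gaussian, now concentrated at v. As
  \<open>e n\<close> tends to 0, dominated convergence applies on both sides: by integrability of
  the transform on one, by boundedness and continuity of f on the other.\<close>

theorem fourier_inversion:
  fixes f :: "real \<Rightarrow> complex"
  assumes f: "integrable lborel f" and cont: "continuous_on UNIV f" and bdd: "\<And>x. norm (f x) \<le> B"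
    and F: "integrable lborel (fourier f)"
  shows "f v = 1 / (2 * pi) * (LINT y|lborel. fourier f y * iexp (y * v))"
proof -
  let ?\<phi> = std_normal_density
  have [measurable]: "f \<in> borel_measurable borel" using f by auto
  define e where "e n = 1 / real (Suc n)" for n
  have e: "e n > 0" "e n \<noteq> 0" for n by (simp_all add: e_def)
  have e0: "e \<longlonglongrightarrow> 0" unfolding e_def by real_asymp
  have eq: "(LINT y|lborel. fourier f y * iexp (y * v) * of_real (?\<phi> (e n * y))) =
        sqrt (2 * pi) * (LINT u|lborel. f (v - e n * u) * of_real (?\<phi> u))" (is "?l n = ?r n") for n
  proof -
    define k where "k x y = f x * of_real (?\<phi> (e n * y)) * iexp (y * (v - x))" for x y
    have int: "integrable (lborel \<Otimes>\<^sub>M lborel) (case_prod k)"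
    proof -
      have "integrable (lborel \<Otimes>\<^sub>M lborel) (\<lambda>p. (case p of (x, y) \<Rightarrow> f x * of_real (?\<phi> (e n * y))) * iexp (snd p * (v - fst p)))"
        by (rule integrable_times_bounded[where B = 1, OF integrable_pair_product[OF f std_normal_scaled_integral(2)[OF e(1)]]]) simp_all
      also have "(\<lambda>p. (case p of (x, y) \<Rightarrow> f x * of_real (?\<phi> (e n * y))) * iexp (snd p * (v - fst p))) = case_prod k"
        by (auto simp: k_def)
      finally show ?thesis .
    qed
    have "fourier f y * iexp (y * v) * of_real (?\<phi> (e n * y)) = (LINT x|lborel. k x y)" for y
    proof -
      have "(LINT x|lborel. k x y) = (LINT x|lborel. (iexp (y * v) * of_real (?\<phi> (e n * y))) * (f x * iexp (- (y * x))))"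
      proof (intro Bochner_Integration.integral_cong refl)
        fix x
        have "iexp (y * (v - x)) = iexp (y * v) * iexp (- (y * x))"
          by (simp add: exp_add[symmetric] algebra_simps)
        then show "k x y = (iexp (y * v) * of_real (?\<phi> (e n * y))) * (f x * iexp (- (y * x)))"
          by (simp add: k_def mult_ac)
      qed
      also have "\<dots> = (iexp (y * v) * of_real (?\<phi> (e n * y))) * fourier f y"
        unfolding fourier_def by (rule integral_mult_right_zero)
      finally show ?thesis by (simp only: mult_ac)
    qed
    then have "?l n = (LINT y|lborel. LINT x|lborel. k x y)" by simp
    also have "\<dots> = (LINT x|lborel. LINT y|lborel. k x y)"
      by (rule lborel_pair.Fubini_integral[OF int])
    also have "\<dots> = (LINT x|lborel. f x * of_real (sqrt (2 * pi) / e n * ?\<phi> ((v - x) / e n)))"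
    proof (intro Bochner_Integration.integral_cong refl)
      fix x
      show "(LINT y|lborel. k x y) = f x * of_real (sqrt (2 * pi) / e n * ?\<phi> ((v - x) / e n))"
        using std_normal_scaled_integral(1)[OF e(1), of n "v - x"]
        by (simp add: k_def mult.assoc mult.commute[of _ "v - x"])
    qed
    \<comment> \<open>The substitution x = v - \<open>e n\<close> u turns the shrinking Gaussian
      into a fixed density, so that the limit concerns only the argument of f.\<close>
    also have "(LINT x|lborel. f x * of_real (sqrt (2 * pi) / e n * ?\<phi> ((v - x) / e n))) =
        \<bar>- e n\<bar> *\<^sub>R (LINT u|lborel. f (v + (- e n) * u) * of_real (sqrt (2 * pi) / e n * ?\<phi> ((v - (v + (- e n) * u)) / e n)))"
      by (rule lborel_integral_real_affine) (use e in auto)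
    also have "\<dots> = e n *\<^sub>R (LINT u|lborel. complex_of_real (sqrt (2 * pi) / e n) * (f (v - e n * u) * of_real (?\<phi> u)))"
      using e(1)[of n] e(2)[of n] by (simp add: mult_ac)
    also have "\<dots> = ?r n"
      using e(2)[of n] by (simp add: scaleR_conv_of_real)
    finally show ?thesis .
  qed
  have "?r \<longlonglongrightarrow> sqrt (2 * pi) * (LINT u|lborel. f v * of_real (?\<phi> u))"
  proof (intro tendsto_mult tendsto_const integral_dominated_convergence[where w = "\<lambda>u. B * ?\<phi> u"])
    show "integrable lborel (\<lambda>u. B * ?\<phi> u)" using integrable_std_normal_moment[of 0] by simp
    show "AE u in lborel. (\<lambda>n. f (v - e n * u) * of_real (?\<phi> u)) \<longlonglongrightarrow> f v * of_real (?\<phi> u)"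
    proof (intro AE_I2 tendsto_mult tendsto_const)
      fix u
      have "(\<lambda>n. v - e n * u) \<longlonglongrightarrow> v - 0 * u" by (intro tendsto_intros e0)
      then show "(\<lambda>n. f (v - e n * u)) \<longlonglongrightarrow> f v"
        by (intro continuous_on_tendsto_compose[OF cont]) auto
    qed
    show "AE u in lborel. norm (f (v - e n * u) * of_real (?\<phi> u)) \<le> B * ?\<phi> u" for n
      using bdd by (auto simp: norm_mult normal_density_nonneg intro!: mult_right_mono)
  qed simp_all
  moreover have "(LINT u|lborel. f v * of_real (?\<phi> u)) = f v"
    using std_normal_scaled_integral(1)[of 1 0] by (simp add: std_normal_density_def)
  ultimately have r: "?r \<longlonglongrightarrow> sqrt (2 * pi) * f v" by simp
  have l: "?l \<longlonglongrightarrow> (LINT y|lborel. fourier f y * iexp (y * v) * of_real (?\<phi> 0))"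
  proof (intro integral_dominated_convergence[where w = "\<lambda>y. norm (fourier f y)"])
    show "integrable lborel (\<lambda>y. norm (fourier f y))" using F by simp
    show "AE y in lborel. (\<lambda>n. fourier f y * iexp (y * v) * of_real (?\<phi> (e n * y)))
            \<longlonglongrightarrow> fourier f y * iexp (y * v) * of_real (?\<phi> 0)"
    proof (intro AE_I2 tendsto_mult tendsto_const tendsto_of_real)
      fix y
      have "(\<lambda>n. e n * y) \<longlonglongrightarrow> 0 * y" by (intro tendsto_intros e0)
      moreover have "continuous_on UNIV ?\<phi>"
        unfolding std_normal_density_def by (intro continuous_intros) auto
      ultimately show "(\<lambda>n. ?\<phi> (e n * y)) \<longlonglongrightarrow> ?\<phi> 0"
        by (intro continuous_on_tendsto_compose[of UNIV ?\<phi>]) auto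
    qed
    have "?\<phi> x \<le> 1" for x
    proof -
      have "1 / sqrt (2 * pi) \<le> 1" using pi_gt3 by simp
      then have "1 / sqrt (2 * pi) * exp (- x\<^sup>2 / 2) \<le> 1 * 1" by (intro mult_mono) auto
      then show ?thesis by (simp add: std_normal_density_def)
    qed
    then show "AE y in lborel. norm (fourier f y * iexp (y * v) * of_real (?\<phi> (e n * y))) \<le> norm (fourier f y)" for n
      by (intro AE_I2) (simp add: norm_mult mult_left_le normal_density_nonneg)
  qed simp_all
  define s where "s = sqrt (2 * pi)"
  have s0: "s \<noteq> 0" by (simp add: s_def)
  have "(LINT y|lborel. fourier f y * iexp (y * v) * of_real (?\<phi> 0)) = sqrt (2 * pi) * f v"
    using LIMSEQ_unique[OF l] r unfolding eq by blast
  then have "(LINT y|lborel. fourier f y * iexp (y * v)) * of_real (1 / s) = s * f v"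
    by (simp add: std_normal_density_def s_def)
  then have "(LINT y|lborel. fourier f y * iexp (y * v)) = of_real (s * s) * f v"
    using s0 by (simp add: field_simps)
  also have "s * s = 2 * pi" using pi_gt_zero by (simp add: s_def)
  finally show ?thesis by simp
qed

section \<open>Moving a vertical line of integration\<close>

lemma integrable_over_1_plus_square: "integrable lborel (\<lambda>y::real. M / (1 + y\<^sup>2))"
  using integrable_inverse_1_plus_square
  by (auto simp: set_integrable_def divide_inverse intro!: integrable_mult_right)

text \<open>A primitive F on the convex strip replaces the rectangular contour. Truncated vertical
  integrals are differences of values of F, and along the horizontal sides F changes by at most (d -
  c) M / (1 + t^2), which tends to 0.\<close>

lemma vertical_line_shift:
  fixes \<Psi> :: "complex \<Rightarrow> complex"
  assumes holo: "\<Psi> holomorphic_on {q. a < Re q \<and> Re q < b}" and cd: "a < c" "c \<le> d" "d < b"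
    and bound: "\<And>q. c \<le> Re q \<Longrightarrow> Re q \<le> d \<Longrightarrow> norm (\<Psi> q) \<le> M / (1 + (Im q)\<^sup>2)"
  shows "(LINT y|lborel. \<Psi> (Complex d y)) = (LINT y|lborel. \<Psi> (Complex c y))"
proof -
  define S where "S = {q. a < Re q \<and> Re q < b}"
  have S: "S = {q. Re q > a} \<inter> {q. Re q < b}" by (auto simp: S_def)
  have "open S" unfolding S by (intro open_Int open_halfspace_Re_gt open_halfspace_Re_lt)
  have "convex S" unfolding S by (intro convex_Int convex_halfspace_Re_gt convex_halfspace_Re_lt)
  have contS: "continuous_on S \<Psi>"
    using holo by (simp add: S_def holomorphic_on_imp_continuous_on)
  obtain F where F': "\<And>q. q \<in> S \<Longrightarrow> (F has_field_derivative \<Psi> q) (at q within S)"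
    using holomorphic_convex_primitive'[OF \<open>convex S\<close> \<open>open S\<close> holo[folded S_def]] by blast
  then have F: "(F has_field_derivative \<Psi> q) (at q)" if "q \<in> S" for q
    using that \<open>open S\<close> by (metis at_within_open)
  have M: "M \<ge> 0" using order_trans[OF norm_ge_zero bound[of "Complex c 0"]] cd by simp
  have vert: "(LINT y|lborel. indicator {- real n..real n} y *\<^sub>R \<Psi> (Complex x y)) =
      (F (Complex x (real n)) - F (Complex x (- real n))) / \<i>" if x: "c \<le> x" "x \<le> d" for x n
  proof -
    have xS: "Complex x y \<in> S" for y using x cd by (simp add: S_def)
    have "(LINT y|lborel. indicator {- real n..real n} y *\<^sub>R \<Psi> (Complex x y)) =
      F (Complex x (real n)) / \<i> - F (Complex x (- real n)) / \<i>"
    proof (rule integral_FTC_Icc)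
      fix y
      have "((\<lambda>y. Complex x y) has_vector_derivative \<i>) (at y)"
        unfolding Complex_eq by (auto intro!: derivative_eq_intros)
      from field_vector_diff_chain_at[OF this F[OF xS]]
      have "((\<lambda>y. F (Complex x y)) has_vector_derivative \<i> * \<Psi> (Complex x y)) (at y)"
        by (simp add: o_def)
      from has_vector_derivative_mult_right[OF this, of "1 / \<i>"]
      have "((\<lambda>y. F (Complex x y) / \<i>) has_vector_derivative \<Psi> (Complex x y)) (at y)" by simp
      then show "((\<lambda>y. F (Complex x y) / \<i>) has_vector_derivative \<Psi> (Complex x y)) (at y within {- real n..real n})"
        by (rule has_vector_derivative_at_within)
    next
      show "continuous_on {- real n..real n} (\<lambda>y. \<Psi> (Complex x y))"
        unfolding Complex_eq
        by (rule continuous_on_compose2[OF contS]) (use xS in \<open>auto intro!: continuous_intros simp: Complex_eq\<close>)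
    qed simp
    then show ?thesis by (simp add: algebra_simps)
  qed
  have line: "(\<lambda>n. LINT y|lborel. indicator {- real n..real n} y *\<^sub>R \<Psi> (Complex x y))
       \<longlonglongrightarrow> (LINT y|lborel. \<Psi> (Complex x y))" if x: "c \<le> x" "x \<le> d" for x
  proof (rule integral_dominated_convergence[where w = "\<lambda>y. M / (1 + y\<^sup>2)"])
    have "continuous_on UNIV (\<lambda>y. \<Psi> (Complex x y))"
      unfolding Complex_eq
      by (rule continuous_on_compose2[OF contS]) (use x cd in \<open>auto intro!: continuous_intros simp: S_def\<close>)
    then have [measurable]: "(\<lambda>y. \<Psi> (Complex x y)) \<in> borel_measurable borel"
      by (rule borel_measurable_continuous_onI)
    show "(\<lambda>y. \<Psi> (Complex x y)) \<in> borel_measurable lborel"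
      "(\<lambda>y. indicator {- real n..real n} y *\<^sub>R \<Psi> (Complex x y)) \<in> borel_measurable lborel" for n
      by measurable
    show "integrable lborel (\<lambda>y. M / (1 + y\<^sup>2))" by (rule integrable_over_1_plus_square)
    show "AE y in lborel. (\<lambda>n. indicator {- real n..real n} y *\<^sub>R \<Psi> (Complex x y)) \<longlonglongrightarrow> \<Psi> (Complex x y)"
    proof (intro AE_I2 tendsto_eventually)
      fix y :: real
      show "\<forall>\<^sub>F n in sequentially. indicator {- real n..real n} y *\<^sub>R \<Psi> (Complex x y) = \<Psi> (Complex x y)"
        using eventually_ge_at_top[of "nat \<lceil>\<bar>y\<bar>\<rceil>"]
        by eventually_elim (auto simp: indicator_def nat_ceiling_le_eq abs_le_iff)
    qed
    show "AE y in lborel. norm (indicator {- real n..real n} y *\<^sub>R \<Psi> (Complex x y)) \<le> M / (1 + y\<^sup>2)" for n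
      using bound[of "Complex x _"] x M by (intro AE_I2) (auto simp: indicator_def)
  qed
  have horiz: "norm (F (Complex d t) - F (Complex c t)) \<le> M / (1 + t\<^sup>2) * (d - c)" for t
  proof -
    have "norm (F (Complex d t) - F (Complex c t)) \<le> M / (1 + t\<^sup>2) * norm (Complex d t - Complex c t)"
    proof (rule field_differentiable_bound[of "closed_segment (Complex c t) (Complex d t)" F \<Psi>])
      fix z assume "z \<in> closed_segment (Complex c t) (Complex d t)"
      then have z: "Im z = t" "c \<le> Re z" "Re z \<le> d"
        using cd by (auto simp: closed_segment_same_Im closed_segment_eq_real_ivl)
      show "norm (\<Psi> z) \<le> M / (1 + t\<^sup>2)" using bound[of z] z by simp
      show "(F has_field_derivative \<Psi> z) (at z within closed_segment (Complex c t) (Complex d t))"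
        by (rule has_field_derivative_at_within[OF F]) (use z cd in \<open>auto simp: S_def\<close>)
    qed auto
    also have "norm (Complex d t - Complex c t) = d - c"
      using cd by (simp add: norm_complex_def)
    finally show ?thesis .
  qed
  have "(\<lambda>n. (LINT y|lborel. indicator {- real n..real n} y *\<^sub>R \<Psi> (Complex d y)) -
             (LINT y|lborel. indicator {- real n..real n} y *\<^sub>R \<Psi> (Complex c y))) \<longlonglongrightarrow> 0"
  proof (rule Lim_null_comparison)
    show "\<forall>\<^sub>F n in sequentially. norm ((LINT y|lborel. indicator {- real n..real n} y *\<^sub>R \<Psi> (Complex d y)) -
             (LINT y|lborel. indicator {- real n..real n} y *\<^sub>R \<Psi> (Complex c y))) \<le> 2 * (M / (1 + (real n)\<^sup>2) * (d - c))"
    proof (intro always_eventually allI)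
      fix n
      have "(LINT y|lborel. indicator {- real n..real n} y *\<^sub>R \<Psi> (Complex d y)) -
             (LINT y|lborel. indicator {- real n..real n} y *\<^sub>R \<Psi> (Complex c y)) =
          ((F (Complex d n) - F (Complex c n)) - (F (Complex d (- real n)) - F (Complex c (- real n)))) / \<i>"
        using cd by (simp add: vert algebra_simps)
      also have "norm \<dots> \<le> norm (F (Complex d n) - F (Complex c n)) + norm (F (Complex d (- real n)) - F (Complex c (- real n)))"
        unfolding norm_divide norm_ii div_by_1 by (rule norm_triangle_ineq4)
      also have "\<dots> \<le> 2 * (M / (1 + (real n)\<^sup>2) * (d - c))"
        using horiz[of "real n"] horiz[of "- real n"] by simp
      finally show "norm ((LINT y|lborel. indicator {- real n..real n} y *\<^sub>R \<Psi> (Complex d y)) -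
             (LINT y|lborel. indicator {- real n..real n} y *\<^sub>R \<Psi> (Complex c y))) \<le> 2 * (M / (1 + (real n)\<^sup>2) * (d - c))" .
    qed
    show "(\<lambda>n. 2 * (M / (1 + (real n)\<^sup>2) * (d - c))) \<longlonglongrightarrow> 0" by real_asymp
  qed
  moreover have "(\<lambda>n. (LINT y|lborel. indicator {- real n..real n} y *\<^sub>R \<Psi> (Complex d y)) -
             (LINT y|lborel. indicator {- real n..real n} y *\<^sub>R \<Psi> (Complex c y))) \<longlonglongrightarrow>
      (LINT y|lborel. \<Psi> (Complex d y)) - (LINT y|lborel. \<Psi> (Complex c y))"
    by (intro tendsto_diff line) (use cd in auto)
  ultimately show ?thesis using LIMSEQ_unique by fastforce
qed

section \<open>Convolution on the real line\<close>

definition conv :: "(real \<Rightarrow> complex) \<Rightarrow> (real \<Rightarrow> complex) \<Rightarrow> real \<Rightarrow> complex" where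
  "conv f g v = (LINT w|lborel. f (v - w) * g w)"

lemma integrable_conv_kernel:
  fixes f g :: "real \<Rightarrow> complex"
  assumes f: "integrable lborel f" and g: "integrable lborel g"
  shows "integrable (lborel \<Otimes>\<^sub>M lborel) (\<lambda>(w, v). f (v - w) * g w)"
proof (rule lborel_pair.Fubini_integrable)
  have [measurable]: "f \<in> borel_measurable borel" "g \<in> borel_measurable borel"
    using f g by auto
  show "(\<lambda>(w, v). f (v - w) * g w) \<in> borel_measurable (lborel \<Otimes>\<^sub>M lborel)" by measurable
  have shift: "(LINT v|lborel. norm (f (v - w))) = (LINT v|lborel. norm (f v))" for w
    using lborel_integral_real_affine[of 1 "\<lambda>v. norm (f v)" "- w"] by simp
  show "integrable lborel (\<lambda>w. LINT v|lborel. norm (case (w, v) of (w, v) \<Rightarrow> f (v - w) * g w))"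
    using g by (simp add: norm_mult shift)
  have "integrable lborel (\<lambda>v. f (v - w))" for w
    using lborel_integrable_real_affine[OF f, of 1 "- w"] by simp
  then show "AE w in lborel. integrable lborel (\<lambda>v. case (w, v) of (w, v) \<Rightarrow> f (v - w) * g w)"
    by simp
qed

lemma integrable_conv:
  assumes f: "integrable lborel f" and g: "integrable lborel g"
  shows "integrable lborel (conv f g)"
  unfolding conv_def
  using lborel_pair.integrable_snd[OF integrable_conv_kernel[OF f g]] by simp

lemma fourier_conv:
  assumes f: "integrable lborel f" and g: "integrable lborel g"
  shows "fourier (conv f g) y = fourier f y * fourier g y"
proof -
  have [measurable]: "f \<in> borel_measurable borel" "g \<in> borel_measurable borel"
    using f g by auto
  define k where "k w v = f (v - w) * g w * iexp (- (y * v))" for w v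
  have "integrable (lborel \<Otimes>\<^sub>M lborel) (\<lambda>p. (case p of (w, v) \<Rightarrow> f (v - w) * g w) * iexp (- (y * snd p)))"
    by (rule integrable_times_bounded[where B = 1, OF integrable_conv_kernel[OF f g]]) simp_all
  also have "(\<lambda>p. (case p of (w, v) \<Rightarrow> f (v - w) * g w) * iexp (- (y * snd p))) = case_prod k"
    by (auto simp: k_def)
  finally have int: "integrable (lborel \<Otimes>\<^sub>M lborel) (case_prod k)" .
  have "fourier (conv f g) y = (LINT v|lborel. LINT w|lborel. k w v)"
    unfolding fourier_def conv_def k_def by simp
  also have "\<dots> = (LINT w|lborel. LINT v|lborel. k w v)"
    by (rule lborel_pair.Fubini_integral[OF int])
  also have "\<dots> = (LINT w|lborel. fourier f y * (g w * iexp (- (y * w))))"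
  proof (intro Bochner_Integration.integral_cong refl)
    fix w
    have "(LINT v|lborel. k w v) = (LINT v|lborel. k w (w + v))"
      using lborel_integral_real_affine[of 1 "k w" w] by simp
    also have "\<dots> = (LINT v|lborel. (f v * iexp (- (y * v))) * (g w * iexp (- (y * w))))"
    proof (intro Bochner_Integration.integral_cong refl)
      fix v
      have "iexp (- (y * (w + v))) = iexp (- (y * v)) * iexp (- (y * w))"
        by (simp add: exp_add[symmetric] algebra_simps)
      then show "k w (w + v) = (f v * iexp (- (y * v))) * (g w * iexp (- (y * w)))"
        by (simp add: k_def mult_ac)
    qed
    finally show "(LINT v|lborel. k w v) = fourier f y * (g w * iexp (- (y * w)))"
      by (simp add: fourier_def)
  qed
  finally show ?thesis by (simp add: fourier_def)
qed

text \<open>The jump of f at 0, typical of kernels cut off to the half line, affects the integrand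
  only at w = v, a null set. Convolution with an integrable g therefore smooths it away.\<close>

lemma continuous_conv:
  assumes f: "\<And>x. norm (f x) \<le> B" "continuous_on (- {0}) f" and [measurable]: "f \<in> borel_measurable borel"
    and g: "integrable lborel g"
  shows "continuous_on UNIV (conv f g)"
proof -
  have [measurable]: "g \<in> borel_measurable borel" using g by auto
  show ?thesis
  proof (rule continuous_on_sequentiallyI)
    fix u :: "nat \<Rightarrow> real" and v :: real
    assume u: "u \<longlonglongrightarrow> v"
    show "(\<lambda>n. conv f g (u n)) \<longlonglongrightarrow> conv f g v"
      unfolding conv_def
    proof (rule integral_dominated_convergence[where w = "\<lambda>w. B * norm (g w)"])
      show "integrable lborel (\<lambda>w. B * norm (g w))" using g by simp
      have "AE w in lborel. w \<noteq> v" by (rule AE_lborel_singleton)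
      then show "AE w in lborel. (\<lambda>n. f (u n - w) * g w) \<longlonglongrightarrow> f (v - w) * g w"
      proof eventually_elim
        case (elim w)
        have "isCont f (v - w)"
          using f(2) elim by (subst (asm) continuous_on_eq_continuous_at) auto
        then show ?case
          by (intro tendsto_mult tendsto_const isCont_tendsto_compose[of _ f] tendsto_diff u)
      qed
      show "AE w in lborel. norm (f (u n - w) * g w) \<le> B * norm (g w)" for n
        using f(1) by (intro AE_I2) (simp add: norm_mult mult_right_mono)
    qed simp_all
  qed
qed

section \<open>Laplace transforms\<close>

lemma integrable_exp_half_line:
  assumes "c > 0"
  shows "integrable lborel (\<lambda>v. indicator {0..} v * exp (- (c * v)) :: real)"
proof -
  have "integrable lborel (\<lambda>v. indicator {0<..} v * exp (- (c * v)) :: real)"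
    using integrable_I0i_exp_mscale[OF assms] by (simp add: set_integrable_def mult.commute)
  then show ?thesis
  proof (rule integrable_cong_AE_imp)
    have "AE v in lborel. v \<noteq> (0::real)" by (rule AE_lborel_singleton)
    then show "AE v in lborel. indicator {0<..} v * exp (- (c * v)) = indicator {0..} v * exp (- (c * v))"
      by eventually_elim (auto simp: indicator_def)
  qed simp
qed

lemma integrable_exp_bounded:
  fixes f :: "real \<Rightarrow> complex"
  assumes [measurable]: "f \<in> borel_measurable borel" and "c > 0"
    and "\<And>v. norm (f v) \<le> indicator {0..} v * (C * exp (- (c * v)))"
  shows "integrable lborel f"
    and "norm (LINT v|lborel. f v) \<le> C * (LINT v|lborel. indicator {0..} v * exp (- (c * v)))"
proof -
  have i: "integrable lborel (\<lambda>v. C * (indicator {0..} v * exp (- (c * v))))"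
    using integrable_exp_half_line[OF \<open>c > 0\<close>] by simp
  have b: "norm (f v) \<le> C * (indicator {0..} v * exp (- (c * v)))" for v
    using assms(3)[of v] by (simp add: mult_ac)
  show "integrable lborel f"
    by (rule Bochner_Integration.integrable_bound[OF i])
       (use b in \<open>auto intro!: AE_I2 order_trans[OF b]\<close>)
  have "norm (LINT v|lborel. f v) \<le> (LINT v|lborel. C * (indicator {0..} v * exp (- (c * v))))"
    by (rule Bochner_Integration.integral_norm_bound_integral[OF \<open>integrable lborel f\<close> i]) (rule b)
  then show "norm (LINT v|lborel. f v) \<le> C * (LINT v|lborel. indicator {0..} v * exp (- (c * v)))"
    by simp
qed

lemma integral_FTC_half_line:
  fixes F f :: "real \<Rightarrow> complex"
  assumes F: "\<And>v. (F has_vector_derivative f v) (at v)" and cont: "continuous_on UNIV f"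
    and lim: "(F \<longlongrightarrow> 0) at_top"
    and "c > 0" and bound: "\<And>v. v \<ge> 0 \<Longrightarrow> norm (f v) \<le> C * exp (- (c * v))"
  shows "(LINT v|lborel. indicator {0..} v *\<^sub>R f v) = - F 0"
    and "integrable lborel (\<lambda>v. indicator {0..} v *\<^sub>R f v)"
proof -
  have [measurable]: "f \<in> borel_measurable borel"
    by (rule borel_measurable_continuous_onI[OF cont])
  have C: "C \<ge> 0" using order_trans[OF norm_ge_zero bound[of 0]] by simp
  have i: "integrable lborel (\<lambda>v. C * (indicator {0..} v * exp (- (c * v))))"
    using integrable_exp_half_line[OF \<open>c > 0\<close>] by simp
  show "integrable lborel (\<lambda>v. indicator {0..} v *\<^sub>R f v)"
    by (rule integrable_exp_bounded(1)[where c = c and C = C])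
       (use bound \<open>c > 0\<close> in \<open>auto simp: indicator_def\<close>)
  have "(\<lambda>n. LINT v|lborel. indicator {0..real n} v *\<^sub>R f v) \<longlonglongrightarrow> (LINT v|lborel. indicator {0..} v *\<^sub>R f v)"
  proof (rule integral_dominated_convergence[where w = "\<lambda>v. C * (indicator {0..} v * exp (- (c * v)))"])
    show "AE v in lborel. (\<lambda>n. indicator {0..real n} v *\<^sub>R f v) \<longlonglongrightarrow> indicator {0..} v *\<^sub>R f v"
    proof (intro AE_I2 tendsto_eventually)
      fix v :: real
      show "\<forall>\<^sub>F n in sequentially. indicator {0..real n} v *\<^sub>R f v = indicator {0..} v *\<^sub>R f v"
        using eventually_ge_at_top[of "nat \<lceil>v\<rceil>"]
        by eventually_elim (auto simp: indicator_def nat_ceiling_le_eq)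
    qed
    show "AE v in lborel. norm (indicator {0..real n} v *\<^sub>R f v) \<le> C * (indicator {0..} v * exp (- (c * v)))" for n
      using bound C by (intro AE_I2) (auto simp: indicator_def)
  qed (use i in auto)
  moreover have "(LINT v|lborel. indicator {0..real n} v *\<^sub>R f v) = F n - F 0" for n
    by (rule integral_FTC_Icc) (auto intro!: has_vector_derivative_at_within F continuous_on_subset[OF cont])
  moreover have "(\<lambda>n. F (real n) - F 0) \<longlonglongrightarrow> 0 - F 0"
    by (intro tendsto_intros filterlim_compose[OF lim filterlim_real_sequentially])
  ultimately show "(LINT v|lborel. indicator {0..} v *\<^sub>R f v) = - F 0"
    using LIMSEQ_unique by fastforce
qed

lemma has_vector_derivative_exp_mult:
  "((\<lambda>v. exp (- (q * complex_of_real v))) has_vector_derivative - q * exp (- (q * complex_of_real v))) (at v)"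
proof -
  have "((\<lambda>z. exp (- (q * z))) has_field_derivative - q * exp (- (q * complex_of_real v))) (at (complex_of_real v))"
    by (auto intro!: derivative_eq_intros)
  from has_vector_derivative_real_field[OF this] show ?thesis by simp
qed

lemma tendsto_exp_mult_at_top:
  assumes "Re q > 0"
  shows "((\<lambda>v. exp (- (q * complex_of_real v))) \<longlongrightarrow> 0) at_top"
proof (rule tendsto_norm_zero_cancel)
  have "((\<lambda>v. exp (- (Re q * v))) \<longlongrightarrow> 0) at_top"
    using assms by real_asymp
  then show "((\<lambda>v. norm (exp (- (q * complex_of_real v)))) \<longlongrightarrow> 0) at_top"
    by simp
qed

section \<open>Laplace transforms and the symbol of the Volterra equation\<close>

definition laplace :: "(real \<Rightarrow> real) \<Rightarrow> complex \<Rightarrow> complex" where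
  "laplace f q = (LINT v|lborel. of_real (f v) * exp (- (q * of_real v)))"

lemma laplace_exp:
  assumes "Re q > 0"
  shows "(LINT v|lborel. indicator {0..} v *\<^sub>R exp (- (q * of_real v))) = 1 / q"
    and "integrable lborel (\<lambda>v. indicator {0..} v *\<^sub>R exp (- (q * of_real v)))"
proof -
  have q: "q \<noteq> 0" using assms by auto
  have *: "((\<lambda>v. - 1 / q * exp (- (q * of_real v))) has_vector_derivative exp (- (q * of_real v))) (at v)" for v
    using has_vector_derivative_mult_right[OF has_vector_derivative_exp_mult[of q v], of "- 1 / q"] q by simp
  have **: "((\<lambda>v. - 1 / q * exp (- (q * of_real v))) \<longlongrightarrow> 0) at_top"
    using tendsto_mult[OF tendsto_const tendsto_exp_mult_at_top[OF assms], of "- 1 / q"] by simp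
  note FTC = integral_FTC_half_line[OF * _ ** assms, of 1]
  show "(LINT v|lborel. indicator {0..} v *\<^sub>R exp (- (q * of_real v))) = 1 / q"
    by (subst FTC(1)) (auto intro!: continuous_intros)
  show "integrable lborel (\<lambda>v. indicator {0..} v *\<^sub>R exp (- (q * of_real v)))"
    by (rule FTC(2)) (auto intro!: continuous_intros)
qed

text \<open>In the variables \<open>X = exp v\<close>, \<open>t = exp w\<close>, the measure \<open>mult_kernel (v - w) dw\<close> is \<open>2 X / (X + t)\<^sup>2 dt\<close>.\<close>

definition mult_kernel :: "real \<Rightarrow> real" where
  "mult_kernel v = (if v < 0 then 0 else 2 * exp (- v) / (1 + exp (- v))\<^sup>2)"

lemma measurable_mult_kernel [measurable]: "mult_kernel \<in> borel_measurable borel"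
  unfolding mult_kernel_def by measurable

lemma one_plus_exp_neq_zero: "1 + exp (- complex_of_real v) \<noteq> 0"
proof -
  have "1 + exp (- complex_of_real v) = of_real (1 + exp (- v))" by (simp flip: exp_of_real)
  also have "\<dots> \<noteq> 0" by (simp only: of_real_eq_0_iff) (smt (verit) exp_gt_zero)
  finally show ?thesis .
qed

text \<open>Expanding 1 / (1 + exp (- v)) as a geometric series and integrating termwise gives the
  series of \<open>nielsen_beta\<close>. Pairing the terms keeps every partial sum below exp (- Re q
  v), which provides the dominating function.\<close>

lemma logistic_laplace:
  assumes q: "Re q > 0"
  shows "(LINT v|lborel. indicator {0..} v *\<^sub>R (exp (- (q * of_real v)) / (1 + exp (- of_real v)))) = nielsen_beta q"
proof -
  define t where "t n v = indicator {0..} v *\<^sub>R exp (- ((q + of_nat n) * of_real v))" for n :: nat and v :: real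
  have Re: "Re (q + of_nat n) > 0" for n using q by simp
  have t: "integrable lborel (t n)" "(LINT v|lborel. t n v) = 1 / (q + of_nat n)" for n
    unfolding t_def using laplace_exp[OF Re[of n]] by blast+
  have partial: "(\<Sum>n<m. t (2 * n) v - t (2 * n + 1) v) =
     indicator {0..} v *\<^sub>R ((1 - exp (- (2 * of_nat m * of_real v))) * (exp (- (q * of_real v)) / (1 + exp (- of_real v))))" for m v
  proof (induction m)
    case (Suc m)
    define E where "E = exp (- complex_of_real v)"
    have E: "1 + E \<noteq> 0" unfolding E_def by (rule one_plus_exp_neq_zero)
    have E1: "exp (- (2 * of_nat m * complex_of_real v)) = E ^ (2 * m)" for m
      unfolding E_def by (simp flip: exp_of_nat_mult add: mult_ac)
    have E2: "exp (- ((q + of_nat k) * complex_of_real v)) = E ^ k * exp (- (q * of_real v))" for k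
      unfolding E_def by (simp flip: exp_of_nat_mult exp_add add: algebra_simps)
    have "(\<Sum>n<Suc m. t (2 * n) v - t (2 * n + 1) v) = indicator {0..} v *\<^sub>R
       ((1 - E ^ (2 * m)) * (exp (- (q * of_real v)) / (1 + E)) + (E ^ (2 * m) - E ^ (2 * m + 1)) * exp (- (q * of_real v)))"
      unfolding sum.lessThan_Suc Suc.IH unfolding t_def E1 E2 E_def[symmetric] by (simp add: algebra_simps)
    also have "(1 - E ^ (2 * m)) * (exp (- (q * of_real v)) / (1 + E)) + (E ^ (2 * m) - E ^ (2 * m + 1)) * exp (- (q * of_real v))
       = (1 - E ^ (2 * Suc m)) * (exp (- (q * of_real v)) / (1 + E))"
      using E by (simp add: divide_simps) (simp add: algebra_simps)
    finally show ?case unfolding E1 E_def[symmetric] .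
  qed simp
  have "(\<lambda>m. LINT v|lborel. (\<Sum>n<m. t (2 * n) v - t (2 * n + 1) v)) \<longlonglongrightarrow>
      (LINT v|lborel. indicator {0..} v *\<^sub>R (exp (- (q * of_real v)) / (1 + exp (- of_real v))))"
  proof (rule integral_dominated_convergence[where w = "\<lambda>v. indicator {0..} v * exp (- (Re q * v))"])
    show "integrable lborel (\<lambda>v. indicator {0..} v * exp (- (Re q * v)) :: real)"
      by (rule integrable_exp_half_line[OF q])
    have "continuous_on UNIV (\<lambda>v. exp (- (q * complex_of_real v)) / (1 + exp (- of_real v)))"
      using one_plus_exp_neq_zero by (intro continuous_intros) auto
    from borel_measurable_continuous_onI[OF this]
    show "(\<lambda>v. indicator {0..} v *\<^sub>R (exp (- (q * complex_of_real v)) / (1 + exp (- of_real v)))) \<in> borel_measurable lborel"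
      by simp
    show "(\<lambda>v. \<Sum>n<m. t (2 * n) v - t (2 * n + 1) v) \<in> borel_measurable lborel" for m
      using t(1) by (intro borel_measurable_sum borel_measurable_diff borel_measurable_integrable)
    \<comment> \<open>At v = 0 all paired partial sums vanish while the limit function is 1/2, so
      this point has to be discarded.\<close>
    have "AE v in lborel. v \<noteq> (0::real)" by (rule AE_lborel_singleton)
    then show "AE v in lborel. (\<lambda>m. \<Sum>n<m. t (2 * n) v - t (2 * n + 1) v) \<longlonglongrightarrow>
      indicator {0..} v *\<^sub>R (exp (- (q * of_real v)) / (1 + exp (- of_real v)))"
    proof eventually_elim
      case (elim v)
      show ?case
      proof (cases "v > 0")
        case True
        have "(\<lambda>m. exp (- (2 * real m * v))) \<longlonglongrightarrow> 0" using True by real_asymp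
        then have "(\<lambda>m. norm (exp (- (2 * of_nat m * complex_of_real v)))) \<longlonglongrightarrow> 0" by simp
        then have "(\<lambda>m. exp (- (2 * of_nat m * complex_of_real v))) \<longlonglongrightarrow> 0"
          by (rule tendsto_norm_zero_cancel)
        then have "(\<lambda>m. indicator {0..} v *\<^sub>R ((1 - exp (- (2 * of_nat m * complex_of_real v))) * (exp (- (q * of_real v)) / (1 + exp (- of_real v)))))
           \<longlonglongrightarrow> indicator {0..} v *\<^sub>R ((1 - 0) * (exp (- (q * of_real v)) / (1 + exp (- of_real v))))"
          by (intro tendsto_intros)
        then show ?thesis unfolding partial by simp
      next
        case False
        then have "indicator {0..} v = (0::real)" using elim by (simp add: indicator_def)
        then show ?thesis unfolding partial by simp
      qed
    qed
    show "AE v in lborel. norm (\<Sum>n<m. t (2 * n) v - t (2 * n + 1) v) \<le> indicator {0..} v * exp (- (Re q * v))" for m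
    proof (intro AE_I2)
      fix v :: real
      show "norm (\<Sum>n<m. t (2 * n) v - t (2 * n + 1) v) \<le> indicator {0..} v * exp (- (Re q * v))"
      proof (cases "v \<ge> 0")
        case True
        have "1 - exp (- (2 * of_nat m * complex_of_real v)) = of_real (1 - exp (- (2 * real m * v)))"
          by (simp flip: exp_of_real)
        then have 1: "norm (1 - exp (- (2 * of_nat m * complex_of_real v))) \<le> 1"
          using True by (simp only: norm_of_real) simp
        have "1 + exp (- complex_of_real v) = of_real (1 + exp (- v))" by (simp flip: exp_of_real)
        then have 2: "norm (1 + exp (- complex_of_real v)) = 1 + exp (- v)"
          by (simp only: norm_of_real) (simp add: add_pos_pos abs_of_pos)
        have "exp (- (Re q * v)) / (1 + exp (- v)) \<le> exp (- (Re q * v)) / 1"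
          by (intro divide_left_mono) (auto simp: add_pos_pos)
        then have "norm (1 - exp (- (2 * of_nat m * complex_of_real v))) * (exp (- (Re q * v)) / (1 + exp (- v))) \<le> 1 * exp (- (Re q * v))"
          using 1 by (intro mult_mono) (auto simp: add_pos_pos)
        then show ?thesis unfolding partial using True by (simp add: norm_mult norm_divide 2)
      qed (simp only: partial, simp)
    qed
  qed
  moreover have "(LINT v|lborel. (\<Sum>n<m. t (2 * n) v - t (2 * n + 1) v)) =
      (\<Sum>n<m. 1 / ((q + 2 * of_nat n) * (q + 2 * of_nat n + 1)))" for m
  proof -
    have "(LINT v|lborel. (\<Sum>n<m. t (2 * n) v - t (2 * n + 1) v)) =
        (\<Sum>n<m. 1 / (q + 2 * of_nat n) - 1 / (q + 2 * of_nat n + 1))"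
      using t by (simp add: Bochner_Integration.integral_sum Bochner_Integration.integral_diff add_ac)
    also have "\<dots> = (\<Sum>n<m. 1 / ((q + 2 * of_nat n) * (q + 2 * of_nat n + 1)))"
      using plus_of_nat_neq_zero[OF q] by (intro sum.cong refl) (simp add: divide_simps)
    finally show ?thesis .
  qed
  ultimately show ?thesis
    using nielsen_beta_sums[OF q] LIMSEQ_unique unfolding sums_def by fastforce
qed

text \<open>Integration by parts: on the half line \<open>mult_kernel\<close> is the derivative of 2
  / (1 + exp (- v)), whose transform is known from \<open>logistic_laplace\<close>, and the boundary
  value at 0 gives the -1. Hence 1 plus this transform is \<open>gstar (- q)\<close>.\<close>

lemma laplace_mult_kernel:
  assumes q: "Re q > 0"
  shows "laplace mult_kernel q = 2 * q * nielsen_beta q - 1"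
proof -
  define g where "g v = exp (- (q * complex_of_real v)) / (1 + exp (- of_real v))" for v
  define h where "h v = exp (- (q * complex_of_real v)) * exp (- of_real v) / (1 + exp (- of_real v))\<^sup>2" for v
  have nz: "1 + exp (- complex_of_real v) \<noteq> 0" for v by (rule one_plus_exp_neq_zero)
  have n1: "norm (1 + exp (- complex_of_real v)) = 1 + exp (- v)" for v
  proof -
    have "1 + exp (- complex_of_real v) = of_real (1 + exp (- v))" by (simp flip: exp_of_real)
    then show ?thesis by (simp only: norm_of_real) (simp add: add_pos_pos abs_of_pos)
  qed
  have cg: "continuous_on UNIV g" and ch: "continuous_on UNIV h"
    unfolding g_def h_def using nz by (auto intro!: continuous_intros)
  have gb: "norm (g v) \<le> 1 * exp (- (Re q * v))" for v
    unfolding g_def norm_divide n1 by (simp add: divide_simps add_pos_pos)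
  have hb: "norm (h v) \<le> 1 * exp (- (Re q * v))" for v
  proof -
    have "exp (- v) / (1 + exp (- v))\<^sup>2 \<le> 1"
      by (simp add: divide_simps power2_eq_square algebra_simps add_pos_pos)
    then have "exp (- (Re q * v)) * (exp (- v) / (1 + exp (- v))\<^sup>2) \<le> exp (- (Re q * v)) * 1"
      by (intro mult_left_mono) auto
    then show ?thesis unfolding h_def norm_divide norm_mult norm_power n1 by simp
  qed
  have deriv: "((\<lambda>v. 2 * g v) has_vector_derivative (2 * h v - 2 * q * g v)) (at v)" for v
  proof -
    have "((\<lambda>z. 2 * (exp (- (q * z)) / (1 + exp (- z)))) has_field_derivative 2 * h v - 2 * q * g v) (at (complex_of_real v))"
      unfolding g_def h_def using nz[of v]
      by (auto intro!: derivative_eq_intros simp: divide_simps power2_eq_square)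
    from has_vector_derivative_real_field[OF this] show ?thesis by (simp add: g_def)
  qed
  have "(g \<longlongrightarrow> 0) at_top"
  proof (rule Lim_null_comparison)
    show "\<forall>\<^sub>F v in at_top. norm (g v) \<le> exp (- (Re q * v))" using gb by simp
    show "((\<lambda>v. exp (- (Re q * v))) \<longlongrightarrow> 0) at_top" using q by real_asymp
  qed
  then have lim: "((\<lambda>v. 2 * g v) \<longlongrightarrow> 0) at_top"
    using tendsto_mult_right_zero by blast
  have bound: "norm (2 * h v - 2 * q * g v) \<le> (2 + 2 * norm q) * exp (- (Re q * v))" for v
  proof -
    have "norm (2 * h v - 2 * q * g v) \<le> norm (2 * h v) + norm (2 * q * g v)" by (rule norm_triangle_ineq4)
    also have "\<dots> = 2 * norm (h v) + 2 * norm q * norm (g v)" by (simp add: norm_mult)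
    also have "\<dots> \<le> 2 * exp (- (Re q * v)) + 2 * norm q * exp (- (Re q * v))"
      using gb[of v] hb[of v] by (intro add_mono mult_left_mono) auto
    finally show ?thesis by (simp add: algebra_simps)
  qed
  have [measurable]: "g \<in> borel_measurable borel" "h \<in> borel_measurable borel"
    by (intro borel_measurable_continuous_onI cg ch)+
  have gi: "integrable lborel (\<lambda>v. indicator {0..} v *\<^sub>R g v)"
    by (rule integrable_exp_bounded(1)[where c = "Re q" and C = 1]) (use q gb in \<open>auto simp: indicator_def\<close>)
  have hi: "integrable lborel (\<lambda>v. indicator {0..} v *\<^sub>R h v)"
    by (rule integrable_exp_bounded(1)[where c = "Re q" and C = 1]) (use q hb in \<open>auto simp: indicator_def\<close>)
  have "- (2 * g 0) = (LINT v|lborel. indicator {0..} v *\<^sub>R (2 * h v - 2 * q * g v))"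
    by (rule integral_FTC_half_line(1)[OF deriv _ lim q bound, symmetric]) (intro continuous_intros cg ch)
  also have "\<dots> = (LINT v|lborel. 2 * (indicator {0..} v *\<^sub>R h v) - 2 * q * (indicator {0..} v *\<^sub>R g v))"
    by (intro Bochner_Integration.integral_cong) (auto simp: algebra_simps)
  also have "\<dots> = 2 * (LINT v|lborel. indicator {0..} v *\<^sub>R h v) - 2 * q * (LINT v|lborel. indicator {0..} v *\<^sub>R g v)"
  proof -
    have "integrable lborel (\<lambda>v. 2 * (indicator {0..} v *\<^sub>R h v))"
      "integrable lborel (\<lambda>v. 2 * q * (indicator {0..} v *\<^sub>R g v))"
      by (intro integrable_mult_right gi hi)+
    then show ?thesis by (simp only: Bochner_Integration.integral_diff integral_mult_right_zero)
  qed
  also have "(LINT v|lborel. indicator {0..} v *\<^sub>R g v) = nielsen_beta q"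
    unfolding g_def by (rule logistic_laplace[OF q])
  finally have "2 * (LINT v|lborel. indicator {0..} v *\<^sub>R h v) = 2 * q * nielsen_beta q - 1"
    by (simp add: g_def algebra_simps)
  moreover have "laplace mult_kernel q = (LINT v|lborel. 2 * (indicator {0..} v *\<^sub>R h v))"
    unfolding laplace_def
    by (intro Bochner_Integration.integral_cong refl)
       (auto simp: mult_kernel_def h_def indicator_def simp flip: exp_of_real)
  ultimately show ?thesis by (simp only: integral_mult_right_zero)
qed

text \<open>The derivative is exhibited directly: the second-order Taylor remainder of the
  exponential bounds the error of the linear approximation by a multiple of |p - q|^2.\<close>

lemma holomorphic_laplace:
  assumes [measurable]: "f \<in> borel_measurable borel"
    and bound: "\<And>v. \<bar>f v\<bar> \<le> indicator {0..} v * (M * exp (- (\<tau> * v)))"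
  shows "laplace f holomorphic_on {q. Re q > - \<tau>}"
proof -
  have "\<exists>D. (laplace f has_field_derivative D) (at q)" if q: "Re q > - \<tau>" for q
  proof -
    \<comment> \<open>The available decay \<tau> + Re q is split into three parts: one absorbs exp
      (|p - q| v), one absorbs v^2, and one is left for integrability.\<close>
    define \<eta> where "\<eta> = (\<tau> + Re q) / 3"
    have \<eta>: "\<eta> > 0" "- \<tau> = Re q - 3 * \<eta>" using q by (auto simp: \<eta>_def field_simps)
    define K where "K = M * (2 / \<eta>\<^sup>2) * (LINT v|lborel. indicator {0..} v * exp (- (\<eta> * v)))"
    have M: "M \<ge> 0" using bound[of 0] by simp
    have v2: "v \<le> 1 / \<eta> * exp (\<eta> * v)" "v\<^sup>2 \<le> 2 / \<eta>\<^sup>2 * exp (\<eta> * v)" if "v \<ge> 0" for v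
    proof -
      have "1 + \<eta> * v + (\<eta> * v)\<^sup>2 / 2 \<le> exp (\<eta> * v)"
        using exp_lower_Taylor_quadratic[of "\<eta> * v"] that \<eta> by simp
      moreover have "\<eta> * v \<ge> 0" "(\<eta> * v)\<^sup>2 \<ge> 0" using that \<eta> by simp_all
      ultimately have "\<eta> * v \<le> exp (\<eta> * v)" "(\<eta> * v)\<^sup>2 / 2 \<le> exp (\<eta> * v)" by linarith+
      then show "v \<le> 1 / \<eta> * exp (\<eta> * v)" "v\<^sup>2 \<le> 2 / \<eta>\<^sup>2 * exp (\<eta> * v)"
        using \<eta> by (simp_all add: field_simps power_mult_distrib)
    qed
    have int: "integrable lborel (\<lambda>v. of_real (f v) * exp (- (p * of_real v)))" if p: "Re p > - \<tau>" for p
    proof (rule integrable_exp_bounded(1)[where c = "\<tau> + Re p" and C = M])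
      fix v
      have "norm (of_real (f v) * exp (- (p * of_real v))) = \<bar>f v\<bar> * exp (- (Re p * v))"
        by (simp add: norm_mult)
      also have "\<dots> \<le> (indicator {0..} v * (M * exp (- (\<tau> * v)))) * exp (- (Re p * v))"
        by (intro mult_right_mono bound) auto
      also have "\<dots> = indicator {0..} v * (M * exp (- ((\<tau> + Re p) * v)))"
        by (simp add: exp_add[symmetric] algebra_simps)
      finally show "norm (of_real (f v) * exp (- (p * of_real v))) \<le> indicator {0..} v * (M * exp (- ((\<tau> + Re p) * v)))" .
    qed (use p in auto)
    have intD: "integrable lborel (\<lambda>v. of_real (f v) * (of_real v * exp (- (q * of_real v))))"
    proof (rule integrable_exp_bounded(1)[where c = \<eta> and C = "M * (1 / \<eta>)"])
      fix v
      show "norm (of_real (f v) * (of_real v * exp (- (q * of_real v)))) \<le> indicator {0..} v * (M * (1 / \<eta>) * exp (- (\<eta> * v)))"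
      proof (cases "v \<ge> 0")
        case True
        have "norm (of_real (f v) * (of_real v * exp (- (q * of_real v)))) = \<bar>f v\<bar> * (v * exp (- (Re q * v)))"
          using True by (simp add: norm_mult)
        also have "\<dots> \<le> (M * exp (- (\<tau> * v))) * ((1 / \<eta> * exp (\<eta> * v)) * exp (- (Re q * v)))"
          using bound[of v] v2[OF True] M True by (intro mult_mono) auto
        also have "\<dots> = M * (1 / \<eta>) * exp (- (\<tau> * v) + \<eta> * v - Re q * v)"
          by (simp add: exp_add exp_diff exp_minus divide_simps)
        also have "- (\<tau> * v) + \<eta> * v - Re q * v = (- \<tau>) * v + \<eta> * v - Re q * v" by simp
        also have "\<dots> = - (2 * \<eta> * v)" unfolding \<eta>(2) by (simp add: algebra_simps)
        also have "M * (1 / \<eta>) * exp (- (2 * \<eta> * v)) \<le> M * (1 / \<eta>) * exp (- (\<eta> * v))"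
          using M \<eta> True by (intro mult_left_mono) auto
        finally show ?thesis using True by simp
      qed (use bound[of v] in simp)
    qed (use \<eta> in auto)
    define D where "D = - (LINT v|lborel. of_real (f v) * (of_real v * exp (- (q * of_real v))))"
    have est: "norm (laplace f p - laplace f q - (p - q) * D) \<le> K * norm (p - q) ^ 2" if p: "norm (p - q) < \<eta>" for p
    proof -
      have "\<bar>Re p - Re q\<bar> \<le> norm (p - q)" using abs_Re_le_cmod[of "p - q"] by simp
      then have Rp: "Re p > - \<tau>" using p \<eta> by linarith
      have "laplace f p - laplace f q - (p - q) * D =
         (LINT v|lborel. of_real (f v) * exp (- (p * of_real v)) - of_real (f v) * exp (- (q * of_real v))
            + (p - q) * (of_real (f v) * (of_real v * exp (- (q * of_real v)))))"
        unfolding laplace_def D_def using int[OF Rp] int[OF q] intD by simp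
      also have "norm \<dots> \<le> (M * (2 / \<eta>\<^sup>2) * norm (p - q) ^ 2) * (LINT v|lborel. indicator {0..} v * exp (- (\<eta> * v)))"
      proof (rule integrable_exp_bounded(2))
        fix v
        let ?F = "of_real (f v) * exp (- (p * of_real v)) - of_real (f v) * exp (- (q * of_real v))
            + (p - q) * (of_real (f v) * (of_real v * exp (- (q * of_real v))))"
        show "norm ?F \<le> indicator {0..} v * (M * (2 / \<eta>\<^sup>2) * norm (p - q) ^ 2 * exp (- (\<eta> * v)))"
        proof (cases "v \<ge> 0")
          case True
          define a where "a = - ((p - q) * complex_of_real v)"
          have na: "norm a = norm (p - q) * v" using True by (simp add: a_def norm_mult)
          have "exp (- (p * of_real v)) = exp (- (q * of_real v)) * exp a"
            by (simp add: a_def exp_add[symmetric] algebra_simps)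
          then have "?F = of_real (f v) * exp (- (q * of_real v)) * (exp a - (1 + a))"
            by (simp add: a_def algebra_simps)
          then have "norm ?F = \<bar>f v\<bar> * exp (- (Re q * v)) * norm (exp a - (1 + a))"
            by (simp add: norm_mult)
          also have "\<dots> \<le> (M * exp (- (\<tau> * v))) * exp (- (Re q * v)) * (exp (\<eta> * v) * (norm (p - q) ^ 2 * (2 / \<eta>\<^sup>2 * exp (\<eta> * v))))"
          proof (intro mult_mono)
            show "\<bar>f v\<bar> \<le> M * exp (- (\<tau> * v))" using bound[of v] True by simp
            have "norm (exp a - (1 + a)) \<le> exp (norm a) * norm a ^ 2"
              using Taylor_exp_field[of a 1] by (simp add: numeral_2_eq_2)
            also have "\<dots> \<le> exp (\<eta> * v) * (norm (p - q) ^ 2 * (2 / \<eta>\<^sup>2 * exp (\<eta> * v)))"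
              unfolding na power_mult_distrib using p True v2(2)[OF True]
              by (intro mult_mono) (auto intro: mult_right_mono)
            finally show "norm (exp a - (1 + a)) \<le> exp (\<eta> * v) * (norm (p - q) ^ 2 * (2 / \<eta>\<^sup>2 * exp (\<eta> * v)))" .
          qed (use M in auto)
          also have "\<dots> = M * (2 / \<eta>\<^sup>2) * norm (p - q) ^ 2 * (exp (- (\<tau> * v)) * exp (- (Re q * v)) * exp (\<eta> * v) * exp (\<eta> * v))"
            by (simp only: mult_ac)
          also have "exp (- (\<tau> * v)) * exp (- (Re q * v)) * exp (\<eta> * v) * exp (\<eta> * v) = exp ((- \<tau>) * v - Re q * v + \<eta> * v + \<eta> * v)"
            by (simp only: exp_add[symmetric]) simp
          also have "(- \<tau>) * v - Re q * v + \<eta> * v + \<eta> * v = - (\<eta> * v)"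
            unfolding \<eta>(2) by (simp add: algebra_simps)
          finally show ?thesis using True by simp
        qed (use bound[of v] in simp)
      qed (use \<eta> in auto)
      finally show ?thesis by (simp add: K_def mult_ac)
    qed
    have "((\<lambda>p. (laplace f p - laplace f q) / (p - q)) \<longlongrightarrow> D) (at q)"
    proof (rule Lim_null[THEN iffD2], rule Lim_null_comparison)
      have "\<forall>\<^sub>F p in at q. dist p q < \<eta> \<and> p \<noteq> q"
        using \<eta>(1) by (auto simp: eventually_at)
      then show "\<forall>\<^sub>F p in at q. norm ((laplace f p - laplace f q) / (p - q) - D) \<le> K * norm (p - q)"
      proof eventually_elim
        case (elim p)
        then have "(laplace f p - laplace f q) / (p - q) - D = (laplace f p - laplace f q - (p - q) * D) / (p - q)"
          by (simp add: field_simps)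
        also have "norm \<dots> \<le> K * norm (p - q) ^ 2 / norm (p - q)"
          unfolding norm_divide using est[of p] elim by (intro divide_right_mono) (auto simp: dist_norm)
        finally show ?case using elim by (simp add: power2_eq_square)
      qed
      have "((\<lambda>p. K * norm (p - q)) \<longlongrightarrow> K * norm (q - q)) (at q)" by (intro tendsto_intros)
      then show "((\<lambda>p. K * norm (p - q)) \<longlongrightarrow> 0) (at q)" by simp
    qed
    then show ?thesis unfolding has_field_derivative_iff by blast
  qed
  then show ?thesis
    by (metis (mono_tags, lifting) field_differentiable_at_within field_differentiable_def holomorphic_onI mem_Collect_eq)
qed

section \<open>Decay of solutions of the Volterra equation\<close>

text \<open>For large q, (q + 1) / \<open>gstar_num q\<close> behaves like 1 - 1 / (2 q). The second
  term is represented by 1 / (2 (q + 3)), half the transform of exp (- 3 v), whose pole lies to the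
  left of every contour in use. What remains is of order |q|^(-2).\<close>

definition resolvent_rest :: "complex \<Rightarrow> complex" where
  "resolvent_rest q = (q + 1) / gstar_num q - 1 + 1 / (2 * (q + 3))"

lemma holomorphic_resolvent_rest:
  "resolvent_rest holomorphic_on {q. Re q > - alpha1}"
  unfolding resolvent_rest_def using alpha1_less_2 gstar_num_nonzero
  by (intro holomorphic_intros holomorphic_gstar_num) (auto simp: complex_eq_iff)

text \<open>Over a common denominator the quadratic and linear terms of the numerator cancel, since
  2 (q + 3) (q + 1) - (2 q + 5) (q + 3/2) = -3/2. The error of \<open>gstar_num\<close> adds at most
  78, while the denominator is at least (Im q)^2. The height 60 makes that error at most 1, hence
  |\<open>gstar_num q\<close>| \<ge> |Im q| / 2.\<close>

lemma resolvent_rest_large: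
  assumes "Re q > -2" "\<bar>Im q\<bar> \<ge> 60"
  shows "norm (resolvent_rest q) \<le> 160 / (1 + (Im q)\<^sup>2)"
proof -
  define \<delta> where "\<delta> = gstar_num q - (q + 3 / 2)"
  have im: "\<bar>Im q\<bar> \<le> norm (q + 2)" "\<bar>Im q\<bar> \<le> norm (q + 3)" "\<bar>Im q\<bar> \<le> norm (q + 3 / 2)"
    using abs_Im_le_cmod[of "q + 2"] abs_Im_le_cmod[of "q + 3"] abs_Im_le_cmod[of "q + 3 / 2"] by simp_all
  have d: "norm \<delta> \<le> 26 / norm (q + 2)"
    unfolding \<delta>_def by (rule gstar_num_asymp) (use assms im in auto)
  also have "\<dots> \<le> 1" using im assms by (simp add: divide_simps)
  finally have d1: "norm \<delta> \<le> 1" .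
  have J: "gstar_num q = q + 3 / 2 + \<delta>" by (simp add: \<delta>_def)
  have "norm (gstar_num q) \<ge> norm (q + 3 / 2) - norm \<delta>"
    unfolding J using norm_diff_ineq by blast
  then have J2: "norm (gstar_num q) \<ge> \<bar>Im q\<bar> / 2" using d1 im assms by linarith
  have J0: "gstar_num q \<noteq> 0" using J2 assms by auto
  have q3: "q + 3 \<noteq> 0" using im assms by auto
  have "resolvent_rest q = (2 * (q + 3) * (q + 1) - (2 * q + 5) * gstar_num q) / (2 * (q + 3) * gstar_num q)"
  proof -
    have "(q + 1) / J - 1 + 1 / (2 * w) = (2 * w * (q + 1) - (2 * w - 1) * J) / (2 * w * J)"
      if "J \<noteq> 0" "w \<noteq> 0" for J w
      using that by (simp add: divide_simps) (simp add: algebra_simps)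
    from this[OF J0 q3] show ?thesis unfolding resolvent_rest_def by (simp add: algebra_simps)
  qed
  also have "2 * (q + 3) * (q + 1) - (2 * q + 5) * gstar_num q = - (3 / 2 + (2 * q + 5) * \<delta>)"
    unfolding J by (simp add: field_simps)
  finally have eq: "resolvent_rest q = - (3 / 2 + (2 * q + 5) * \<delta>) / (2 * (q + 3) * gstar_num q)" .
  have "norm (2 * q + 5) \<le> 3 * norm (q + 2)"
  proof -
    have "norm (2 * (q + 2) + 1) \<le> norm (2 * (q + 2)) + norm (1::complex)" by (rule norm_triangle_ineq)
    moreover have "2 * (q + 2) + 1 = 2 * q + 5" by simp
    ultimately have "norm (2 * q + 5) \<le> 2 * norm (q + 2) + 1" by (simp only: norm_mult) simp
    then show ?thesis using im assms by linarith
  qed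
  then have "norm (2 * q + 5) * norm \<delta> \<le> 3 * norm (q + 2) * (26 / norm (q + 2))"
    using d by (intro mult_mono) auto
  also have "\<dots> = 78" using im assms by (auto simp: divide_simps)
  finally have "norm (3 / 2 + (2 * q + 5) * \<delta>) \<le> 80"
    using norm_triangle_ineq[of "3 / 2" "(2 * q + 5) * \<delta>"] by (simp add: norm_mult)
  moreover have "(Im q)\<^sup>2 \<le> norm (2 * (q + 3) * gstar_num q)"
  proof -
    have "2 * \<bar>Im q\<bar> * (\<bar>Im q\<bar> / 2) \<le> 2 * norm (q + 3) * norm (gstar_num q)"
      using im J2 by (intro mult_mono) auto
    then show ?thesis by (simp only: norm_mult norm_numeral) (simp add: power2_eq_square)
  qed
  moreover have y2: "(Im q)\<^sup>2 \<ge> 1"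
    using power_mono[of 1 "\<bar>Im q\<bar>" 2] assms by simp
  ultimately have "norm (resolvent_rest q) \<le> 80 / (Im q)\<^sup>2"
    unfolding eq norm_divide norm_minus_cancel by (intro frac_le) auto
  also have "\<dots> \<le> 160 / (1 + (Im q)\<^sup>2)"
    using y2 by (simp add: divide_simps)
  finally show ?thesis .
qed

lemma resolvent_rest_bound:
  assumes "s < alpha1"
  obtains M where "\<And>q. - s \<le> Re q \<Longrightarrow> Re q \<le> 1 \<Longrightarrow> norm (resolvent_rest q) \<le> M / (1 + (Im q)\<^sup>2)"
proof -
  define R where "R = cbox (Complex (- s) (- 60)) (Complex 1 60)"
  have sub: "R \<subseteq> {q. Re q > - alpha1}"
    using assms by (auto simp: R_def in_cbox_complex_iff)
  have "compact (resolvent_rest ` R)"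
    unfolding R_def using holomorphic_on_imp_continuous_on[OF holomorphic_resolvent_rest] sub
    by (intro compact_continuous_image compact_cbox) (auto simp: R_def intro: continuous_on_subset)
  then obtain B where B: "\<And>q. q \<in> R \<Longrightarrow> norm (resolvent_rest q) \<le> B"
    by (meson bounded_iff compact_imp_bounded imageI)
  \<comment> \<open>160 serves the part |Im q| \<ge> 60. On the compact rectangle the factor 1 + (Im
    q)^2 is at most 3601 = 1 + 60^2.\<close>
  define M where "M = max 160 (\<bar>B\<bar> * 3601)"
  show ?thesis
  proof (rule that[of M])
    fix q assume q: "- s \<le> Re q" "Re q \<le> 1"
    have pos: "1 + (Im q)\<^sup>2 > 0" by (simp add: add_pos_nonneg)
    show "norm (resolvent_rest q) \<le> M / (1 + (Im q)\<^sup>2)"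
    proof (cases "\<bar>Im q\<bar> \<ge> 60")
      case True
      have "norm (resolvent_rest q) \<le> 160 / (1 + (Im q)\<^sup>2)"
        by (rule resolvent_rest_large) (use True q assms alpha1_less_2 in auto)
      also have "\<dots> \<le> M / (1 + (Im q)\<^sup>2)"
        using pos by (intro divide_right_mono) (auto simp: M_def)
      finally show ?thesis .
    next
      case False
      then have "(Im q)\<^sup>2 \<le> 60\<^sup>2" by (intro abs_le_square_iff[THEN iffD1]) auto
      moreover have "norm (resolvent_rest q) \<le> B"
        using False q by (intro B) (auto simp: R_def in_cbox_complex_iff)
      ultimately have "norm (resolvent_rest q) * (1 + (Im q)\<^sup>2) \<le> \<bar>B\<bar> * 3601"
        by (intro mult_mono) auto
      also have "\<dots> \<le> M" by (simp add: M_def)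
      finally show ?thesis using pos by (simp add: pos_le_divide_eq)
    qed
  qed
qed

text \<open>The weight exp (- v) makes bounded functions on the half line integrable and turns the
  Laplace transform on Re q = 1 into a Fourier transform. It is multiplicative, so it also respects
  convolution.\<close>

definition damp :: "(real \<Rightarrow> real) \<Rightarrow> real \<Rightarrow> complex" where
  "damp f v = of_real (exp (- v) * f v)"

lemma measurable_damp [measurable]: "f \<in> borel_measurable borel \<Longrightarrow> damp f \<in> borel_measurable borel"
  unfolding damp_def by measurable

lemma norm_damp_le:
  assumes "\<bar>f v\<bar> \<le> indicator {0..} v * B"
  shows "norm (damp f v) \<le> indicator {0..} v * (B * exp (- (1 * v)))"
  using mult_left_mono[OF assms, of "exp (- v)"] by (simp add: damp_def norm_mult mult_ac)

lemma integrable_damp: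
  assumes [measurable]: "f \<in> borel_measurable borel"
    and "\<And>v. \<bar>f v\<bar> \<le> indicator {0..} v * B"
  shows "integrable lborel (damp f)"
  by (rule integrable_exp_bounded(1)[where c = 1 and C = B]) (use norm_damp_le[where f = f, OF assms(2)] in auto)

lemma norm_damp_le_const:
  assumes "\<bar>f v\<bar> \<le> indicator {0..} v * B" "B \<ge> 0"
  shows "norm (damp f v) \<le> B"
proof -
  have "indicator {0..} v * (B * exp (- (1 * v))) \<le> B"
    using assms(2) by (auto simp: indicator_def mult_left_le)
  then show ?thesis using norm_damp_le[where f = f, OF assms(1)] by simp
qed

lemma fourier_damp: "fourier (damp f) y = laplace f (Complex 1 y)"
  unfolding fourier_def laplace_def
proof (intro Bochner_Integration.integral_cong refl)
  fix v
  have "- (Complex 1 y * of_real v) = of_real (- v) + \<i> * of_real (- (y * v))"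
    by (simp add: Complex_eq algebra_simps)
  then show "damp f v * iexp (- (y * v)) = of_real (f v) * exp (- (Complex 1 y * of_real v))"
    by (simp only: damp_def exp_add exp_of_real of_real_mult) (simp only: mult_ac)
qed

lemma conv_damp: "conv (damp f) (damp g) v = of_real (exp (- v) * (LINT w|lborel. f (v - w) * g w))"
proof -
  have "conv (damp f) (damp g) v = (LINT w|lborel. complex_of_real (exp (- v) * (f (v - w) * g w)))"
    unfolding conv_def damp_def of_real_mult[symmetric]
  proof (intro Bochner_Integration.integral_cong refl arg_cong[of _ _ complex_of_real])
    fix w
    have "exp (- v) = exp (- (v - w)) * exp (- w)" by (simp add: exp_add[symmetric])
    then show "exp (- (v - w)) * f (v - w) * (exp (- w) * g w) = exp (- v) * (f (v - w) * g w)" by simp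
  qed
  then show ?thesis by (simp only: integral_complex_of_real integral_mult_right_zero)
qed

lemma fourier_linear:
  assumes f: "integrable lborel f" and g: "integrable lborel g"
  shows "fourier (\<lambda>v. a * f v + b * g v) y = a * fourier f y + b * fourier g y"
proof -
  have [measurable]: "f \<in> borel_measurable borel" "g \<in> borel_measurable borel" using f g by auto
  have i: "integrable lborel (\<lambda>v. h v * iexp (- (y * v)))" if "integrable lborel h" for h
    by (rule integrable_times_bounded[where B = 1, OF that]) simp_all
  have "fourier (\<lambda>v. a * f v + b * g v) y =
      (LINT v|lborel. a * (f v * iexp (- (y * v))) + b * (g v * iexp (- (y * v))))"
    unfolding fourier_def by (simp add: algebra_simps)
  also have "\<dots> = a * fourier f y + b * fourier g y"
    unfolding fourier_def using i[OF f] i[OF g]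
    by (subst Bochner_Integration.integral_add) (simp_all only: integral_mult_right_zero integrable_mult_right)
  finally show ?thesis .
qed

lemma norm_conv_le:
  assumes f: "\<And>x. norm (f x) \<le> B" and g: "integrable lborel g"
    and [measurable]: "f \<in> borel_measurable borel"
  shows "norm (conv f g v) \<le> B * (LINT w|lborel. norm (g w))"
proof -
  have [measurable]: "g \<in> borel_measurable borel" using g by auto
  have "integrable lborel (\<lambda>w. g w * f (v - w))"
    by (rule integrable_times_bounded[OF g _ f]) simp
  then have i: "integrable lborel (\<lambda>w. f (v - w) * g w)" by (simp add: mult.commute)
  have "norm (conv f g v) \<le> (LINT w|lborel. B * norm (g w))"
    unfolding conv_def
    by (rule Bochner_Integration.integral_norm_bound_integral[OF i])
       (use g f in \<open>auto simp: norm_mult intro!: mult_right_mono\<close>)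
  then show ?thesis by simp
qed

text \<open>
  With \<open>x\<close>, \<open>k\<close>, \<open>e\<close> the Laplace transforms of the solution, the kernel and the right-hand side,
  \<open>x = e / (1 + k)\<close> and \<open>1 + k = gstar_num q / (q + 1)\<close>. Subtracting \<open>1 - 1 / (2 (q + 3))\<close> from
  \<open>1 / (1 + k)\<close> leaves the integrable \<open>resolvent_rest\<close>, whose contribution to the solution is
  continuous and is estimated by moving the inversion contour to \<open>Re q = - s\<close>.
\<close>

theorem volterra_decay:
  fixes x e :: "real \<Rightarrow> real"
  assumes [measurable]: "x \<in> borel_measurable borel" "e \<in> borel_measurable borel"
    and x: "\<And>v. \<bar>x v\<bar> \<le> indicator {0..} v * B"
    and e: "\<And>v. \<bar>e v\<bar> \<le> indicator {0..} v * (M * exp (- (\<tau> * v)))"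
    and eq: "\<And>v. e v = x v + (LINT w|lborel. mult_kernel (v - w) * x w)"
    and s: "0 < s" "s < \<tau>" "s < alpha1"
  obtains M' where "\<And>v. v \<ge> 0 \<Longrightarrow> \<bar>x v\<bar> \<le> M' * exp (- (s * v))"
proof -
  have M: "M \<ge> 0" using e[of 0] by simp
  have B: "B \<ge> 0" using x[of 0] by simp
  define d where "d v = (if v < 0 then 0 else exp (- (3 * v)))" for v :: real
  have [measurable]: "d \<in> borel_measurable borel"
    unfolding d_def by measurable
  have db: "\<bar>d v\<bar> \<le> indicator {0..} v * 1" for v by (simp add: d_def)
  have kb: "\<bar>mult_kernel v\<bar> \<le> indicator {0..} v * 2" for v
  proof -
    have "2 * exp (- v) \<le> 2 * (1 + exp (- v))\<^sup>2"
      by (simp add: power2_eq_square algebra_simps add_pos_pos less_imp_le)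
    then show ?thesis by (auto simp: mult_kernel_def divide_simps add_pos_pos)
  qed
  have eb: "\<bar>e v\<bar> \<le> indicator {0..} v * M" for v
  proof -
    have "indicator {0..} v * (M * exp (- (\<tau> * v))) \<le> indicator {0..} v * M"
      using M s by (auto simp: indicator_def mult_left_le)
    then show ?thesis using e[of v] by linarith
  qed
  let ?X = "damp x" and ?E = "damp e" and ?K = "damp mult_kernel" and ?D = "damp d"
  have int: "integrable lborel ?X" "integrable lborel ?E" "integrable lborel ?K" "integrable lborel ?D"
    using integrable_damp[OF _ x] integrable_damp[OF _ eb] integrable_damp[OF _ kb] integrable_damp[OF _ db]
    by simp_all
  have intc: "integrable lborel (conv ?K ?X)" "integrable lborel (conv ?D ?E)"
    by (intro integrable_conv int)+
  have EX: "?E = (\<lambda>v. 1 * ?X v + 1 * conv ?K ?X v)"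
    unfolding conv_damp by (rule ext) (simp add: damp_def eq[of _] algebra_simps)
  \<comment> \<open>By \<open>EX\<close>, S equals X - E + (D * E) / 2, the part with transform
    \<open>resolvent_rest\<close> times that of e. Writing it through convolutions shows its
    continuity although X and E may jump.\<close>
  define S where "S v = (- 1) * conv ?K ?X v + (1 / 2) * conv ?D ?E v" for v
  have intS: "integrable lborel S"
    unfolding S_def using intc by (intro Bochner_Integration.integrable_add integrable_mult_right)
  have contS: "continuous_on UNIV S"
    unfolding S_def
  proof (intro continuous_intros continuous_conv[of ?K 2] continuous_conv[of ?D 1] int)
    have nz: "- {0::real} = {..<0} \<union> {0<..}" by auto
    show "continuous_on (- {0}) ?K"
    proof -
      have "continuous_on {..<0} ?K"
        by (rule continuous_on_eq[of _ "\<lambda>_. 0"]) (auto simp: damp_def mult_kernel_def)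
      moreover have "continuous_on {0<..} ?K"
      proof (rule continuous_on_eq[of _ "\<lambda>v. of_real (exp (- v) * (2 * exp (- v) / (1 + exp (- v))\<^sup>2))"])
        have "1 + exp (- v) \<noteq> (0::real)" for v by (smt (verit) exp_gt_zero)
        then show "continuous_on {0<..} (\<lambda>v. complex_of_real (exp (- v) * (2 * exp (- v) / (1 + exp (- v))\<^sup>2)))"
          by (intro continuous_on_of_real continuous_intros) simp
      qed (auto simp: damp_def mult_kernel_def)
      ultimately show ?thesis unfolding nz by (intro continuous_on_open_Un) auto
    qed
    show "continuous_on (- {0}) ?D"
    proof -
      have "continuous_on {..<0} ?D"
        by (rule continuous_on_eq[of _ "\<lambda>_. 0"]) (auto simp: damp_def d_def)
      moreover have "continuous_on {0<..} ?D"
        by (rule continuous_on_eq[of _ "\<lambda>v. of_real (exp (- v) * exp (- (3 * v)))"])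
           (auto simp: damp_def d_def intro!: continuous_intros)
      ultimately show ?thesis unfolding nz by (intro continuous_on_open_Un) auto
    qed
    show "norm (?K v) \<le> 2" for v by (rule norm_damp_le_const[where f = mult_kernel, OF kb]) simp
    show "norm (?D v) \<le> 1" for v by (rule norm_damp_le_const[where f = d, OF db]) simp
  qed simp_all
  obtain BS where BS: "\<And>v. norm (S v) \<le> BS"
  proof -
    have "norm (S v) \<le> 2 * (LINT w|lborel. norm (?X w)) + 1 * (LINT w|lborel. norm (?E w))" for v
    proof -
      have "norm (S v) \<le> norm ((- 1) * conv ?K ?X v) + norm ((1 / 2) * conv ?D ?E v)"
        unfolding S_def by (rule norm_triangle_ineq)
      also have "\<dots> = norm (conv ?K ?X v) + norm (conv ?D ?E v) / 2" by (simp add: norm_mult)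
      also have "\<dots> \<le> norm (conv ?K ?X v) + norm (conv ?D ?E v)" by simp
      also have "norm (conv ?K ?X v) \<le> 2 * (LINT w|lborel. norm (?X w))"
        by (rule norm_conv_le[OF norm_damp_le_const[where f = mult_kernel, OF kb]]) (use int in auto)
      also have "norm (conv ?D ?E v) \<le> 1 * (LINT w|lborel. norm (?E w))"
        by (rule norm_conv_le[OF norm_damp_le_const[where f = d, OF db]]) (use int in auto)
      finally show ?thesis by simp
    qed
    then show ?thesis using that by blast
  qed
  have FS: "fourier S y = resolvent_rest (Complex 1 y) * laplace e (Complex 1 y)" for y
  proof -
    define q where "q = Complex 1 y"
    have q: "Re q > 0" "q \<noteq> 0" "q \<noteq> -1" "q + 1 \<noteq> 0" "q + 3 \<noteq> 0" by (auto simp: q_def complex_eq_iff)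
    have J: "gstar_num q \<noteq> 0" by (rule gstar_num_nonzero) (use s in \<open>simp add: q_def\<close>)
    have FK: "1 + fourier ?K y = gstar_num q / (q + 1)"
      unfolding fourier_damp q_def[symmetric] laplace_mult_kernel[OF q(1)]
      using gstar_eq_nielsen_beta[OF q(2)] gstar_eq[OF q(3)] by simp
    have "laplace d q = 1 / (q + 3)"
    proof -
      have "laplace d q = (LINT v|lborel. indicator {0..} v *\<^sub>R exp (- ((q + 3) * of_real v)))"
        unfolding laplace_def
      proof (intro Bochner_Integration.integral_cong refl)
        fix v
        have "- ((q + 3) * of_real v) = of_real (- (3 * v)) + - (q * of_real v)" by (simp add: algebra_simps)
        then have "exp (- ((q + 3) * of_real v)) = of_real (exp (- (3 * v))) * exp (- (q * of_real v))"
          by (simp only: exp_add exp_of_real)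
        then show "of_real (d v) * exp (- (q * of_real v)) = indicator {0..} v *\<^sub>R exp (- ((q + 3) * of_real v))"
          by (simp only:) (simp add: d_def indicator_def)
      qed
      also have "\<dots> = 1 / (q + 3)" by (rule laplace_exp) (use q in auto)
      finally show ?thesis .
    qed
    then have FD: "fourier ?D y = 1 / (q + 3)" by (simp add: fourier_damp q_def)
    have FE: "fourier ?E y = fourier ?X y * (1 + fourier ?K y)"
      by (subst EX, subst fourier_linear[OF int(1) intc(1)]) (simp add: fourier_conv int algebra_simps)
    then have FX: "fourier ?X y = fourier ?E y * ((q + 1) / gstar_num q)"
      unfolding FK using J q by simp
    have "fourier S y = (- 1) * (fourier ?K y * fourier ?X y) + (1 / 2) * (fourier ?D y * fourier ?E y)"
      unfolding S_def by (simp only: fourier_linear[OF intc] fourier_conv int)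
    also have "(- 1) * (fourier ?K y * fourier ?X y) = fourier ?X y - fourier ?E y"
      unfolding FE by (simp add: algebra_simps)
    also have "\<dots> + (1 / 2) * (fourier ?D y * fourier ?E y) = resolvent_rest q * fourier ?E y"
      unfolding FX FD resolvent_rest_def by (simp add: algebra_simps)
    finally show ?thesis by (simp only: fourier_damp q_def)
  qed
  obtain R where R: "\<And>q. - s \<le> Re q \<Longrightarrow> Re q \<le> 1 \<Longrightarrow> norm (resolvent_rest q) \<le> R / (1 + (Im q)\<^sup>2)"
    using resolvent_rest_bound[OF s(3)] by blast
  define L where "L = M * (LINT v|lborel. indicator {0..} v * exp (- ((\<tau> - s) * v)))"
  have L: "norm (laplace e q) \<le> L" if q: "- s \<le> Re q" for q
    unfolding laplace_def L_def
  proof (rule integrable_exp_bounded(2))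
    fix v :: real
    show "norm (of_real (e v) * exp (- (q * of_real v))) \<le> indicator {0..} v * (M * exp (- ((\<tau> - s) * v)))"
    proof (cases "v \<ge> 0")
      case True
      have "norm (of_real (e v) * exp (- (q * of_real v))) = \<bar>e v\<bar> * exp (- (Re q * v))" by (simp add: norm_mult)
      also have "\<dots> \<le> (M * exp (- (\<tau> * v))) * exp (s * v)"
        using e[of v] True q M mult_right_mono[OF q True] by (intro mult_mono) auto
      also have "\<dots> = M * exp (- ((\<tau> - s) * v))" by (simp add: exp_add[symmetric] algebra_simps)
      finally show ?thesis using True by simp
    qed (use e[of v] in simp)
  qed (use s in auto)
  have L0: "L \<ge> 0" using order_trans[OF norm_ge_zero L[of 0]] s by simp
  have prod: "norm (resolvent_rest q * laplace e q) \<le> R * L / (1 + (Im q)\<^sup>2)" if "- s \<le> Re q" "Re q \<le> 1" for q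
    using mult_mono[OF R[OF that] L[OF that(1)]] order_trans[OF norm_ge_zero R[OF that]]
    by (simp add: norm_mult)
  have intF: "integrable lborel (fourier S)"
  proof (rule Bochner_Integration.integrable_bound[OF integrable_over_1_plus_square[of "R * L"]])
    show "fourier S \<in> borel_measurable lborel" using intS by simp
    show "AE y in lborel. norm (fourier S y) \<le> norm (R * L / (1 + y\<^sup>2))"
    proof (intro AE_I2)
      fix y
      have "norm (fourier S y) \<le> R * L / (1 + y\<^sup>2)"
        unfolding FS using prod[of "Complex 1 y"] s by simp
      also have "\<dots> \<le> norm (R * L / (1 + y\<^sup>2))" unfolding real_norm_def by (rule abs_ge_self)
      finally show "norm (fourier S y) \<le> norm (R * L / (1 + y\<^sup>2))" .
    qed
  qed
  define C where "C = 1 / (2 * pi) * (LINT y|lborel. R * L / (1 + y\<^sup>2))"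
  have S_bound: "norm (complex_of_real (exp v) * S v) \<le> C * exp (- (s * v))" if v: "v \<ge> 0" for v
  proof -
    define \<Psi> where "\<Psi> q = resolvent_rest q * laplace e q * exp (q * of_real v)" for q
    have "complex_of_real (exp v) * S v = 1 / (2 * pi) * (LINT y|lborel. complex_of_real (exp v) * (fourier S y * iexp (y * v)))"
      by (subst fourier_inversion[OF intS contS BS intF]) simp
    also have "(LINT y|lborel. complex_of_real (exp v) * (fourier S y * iexp (y * v))) = (LINT y|lborel. \<Psi> (Complex 1 y))"
    proof (intro Bochner_Integration.integral_cong refl)
      fix y
      have "Complex 1 y * of_real v = of_real v + \<i> * of_real (y * v)"
        by (simp add: Complex_eq algebra_simps)
      then show "complex_of_real (exp v) * (fourier S y * iexp (y * v)) = \<Psi> (Complex 1 y)"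
        unfolding \<Psi>_def FS by (simp only: exp_add exp_of_real) (simp only: mult_ac)
    qed
    also have "\<dots> = (LINT y|lborel. \<Psi> (Complex (- s) y))"
    proof (rule vertical_line_shift)
      show "\<Psi> holomorphic_on {q. - min alpha1 \<tau> < Re q \<and> Re q < 2}"
        unfolding \<Psi>_def
        by (intro holomorphic_intros holomorphic_on_subset[OF holomorphic_resolvent_rest]
            holomorphic_on_subset[OF holomorphic_laplace[OF _ e]]) auto
      show "- min alpha1 \<tau> < - s" "- s \<le> 1" using s by auto
      \<comment> \<open>The factor exp v is harmless, since v is fixed during the shift. The decay
        in v is read off afterwards on the line Re q = - s.\<close>
      show "norm (\<Psi> q) \<le> (R * L * exp v) / (1 + (Im q)\<^sup>2)" if q: "- s \<le> Re q" "Re q \<le> 1" for q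
      proof -
        have "norm (\<Psi> q) \<le> R * L / (1 + (Im q)\<^sup>2) * exp v"
          unfolding \<Psi>_def norm_mult[of "_ * _"] using q v prod[OF q] order_trans[OF norm_ge_zero prod[OF q]]
            mult_right_mono[OF q(2) v]
          by (intro mult_mono) auto
        then show ?thesis by simp
      qed
    qed simp
    also have "norm (complex_of_real (1 / (2 * pi)) * (LINT y|lborel. \<Psi> (Complex (- s) y))) \<le>
       1 / (2 * pi) * (LINT y|lborel. R * L / (1 + y\<^sup>2) * exp (- (s * v)))"
    proof -
      have b: "norm (\<Psi> (Complex (- s) y)) \<le> R * L / (1 + y\<^sup>2) * exp (- (s * v))" for y
        unfolding \<Psi>_def norm_mult[of "_ * _"] using prod[of "Complex (- s) y"] s
        by (intro mult_mono) (auto intro: order_trans[OF norm_ge_zero])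
      have "norm (LINT y|lborel. \<Psi> (Complex (- s) y)) \<le> (LINT y|lborel. R * L / (1 + y\<^sup>2) * exp (- (s * v)))"
      proof (rule Bochner_Integration.integral_norm_bound_integral)
        show i: "integrable lborel (\<lambda>y. R * L / (1 + y\<^sup>2) * exp (- (s * v)))"
          by (intro integrable_mult_left integrable_over_1_plus_square)
        have "continuous_on {q. - min alpha1 \<tau> < Re q} \<Psi>"
          unfolding \<Psi>_def
          by (intro holomorphic_on_imp_continuous_on holomorphic_intros holomorphic_on_subset[OF holomorphic_resolvent_rest]
            holomorphic_on_subset[OF holomorphic_laplace[OF _ e]]) auto
        then have "continuous_on UNIV (\<lambda>y. \<Psi> (Complex (- s) y))"
          unfolding Complex_eq
          by (rule continuous_on_compose2) (use s in \<open>auto intro!: continuous_intros\<close>)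
        then have [measurable]: "(\<lambda>y. \<Psi> (Complex (- s) y)) \<in> borel_measurable borel"
          by (rule borel_measurable_continuous_onI)
        show "integrable lborel (\<lambda>y. \<Psi> (Complex (- s) y))"
          by (rule Bochner_Integration.integrable_bound[OF i], simp)
             (intro AE_I2, unfold real_norm_def, rule order_trans[OF b abs_ge_self])
      qed (use b in auto)
      then show ?thesis unfolding norm_mult norm_of_real by (intro mult_mono) auto
    qed
    also have "\<dots> = C * exp (- (s * v))" by (simp only: C_def integral_mult_left_zero mult.assoc)
    finally show ?thesis .
  qed
  \<comment> \<open>Splitting exp (- 3 (v - w)) into exp (- s (v - w)) exp (- (3 - s) (v - w)) lets
    exp (- s v) be pulled out of the convolution; 3 - s is positive because s <
    \<open>alpha1\<close> < 2.\<close>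
  define C2 where "C2 = M * (LINT u|lborel. indicator {0..} u * exp (- ((3 - s) * u)))"
  have D_bound: "\<bar>LINT w|lborel. d (v - w) * e w\<bar> \<le> C2 * exp (- (s * v))" for v
  proof -
    define \<phi> where "\<phi> u = indicator {0..} u * exp (- ((3 - s) * u))" for u :: real
    have i\<phi>: "integrable lborel \<phi>" unfolding \<phi>_def
      by (rule integrable_exp_half_line) (use s alpha1_less_2 in simp)
    have [measurable]: "\<phi> \<in> borel_measurable borel" using i\<phi> by simp
    have i: "integrable lborel (\<lambda>w. M * exp (- (s * v)) * \<phi> (v - w))"
      using lborel_integrable_real_affine[OF i\<phi>, of "-1" v] by simp
    have b: "norm (d (v - w) * e w) \<le> M * exp (- (s * v)) * \<phi> (v - w)" for w
    proof (cases "w \<ge> 0 \<and> v - w \<ge> 0")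
      case True
      have "norm (d (v - w) * e w) = exp (- (3 * (v - w))) * \<bar>e w\<bar>" using True by (simp add: d_def abs_mult)
      also have "\<bar>e w\<bar> \<le> M * exp (- (\<tau> * w))" using e[of w] True by simp
      also have "\<dots> \<le> M * exp (- (s * w))"
        using M True s by (intro mult_left_mono) (auto intro: mult_right_mono)
      also have "exp (- (3 * (v - w))) * (M * exp (- (s * w))) = M * exp (- (s * v)) * exp (- ((3 - s) * (v - w)))"
        by (simp add: exp_add[symmetric] algebra_simps)
      finally show ?thesis using True by (simp add: \<phi>_def)
    next
      case False
      then have "d (v - w) * e w = 0" using e[of w] by (auto simp: d_def)
      moreover have "0 \<le> M * exp (- (s * v)) * \<phi> (v - w)" using M by (simp add: \<phi>_def)
      ultimately show ?thesis by (simp only: norm_zero)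
    qed
    have "integrable lborel (\<lambda>w. d (v - w) * e w)"
      by (rule Bochner_Integration.integrable_bound[OF i], simp)
         (intro AE_I2 order_trans[OF b], unfold real_norm_def, rule abs_ge_self)
    then have "norm (LINT w|lborel. d (v - w) * e w) \<le> (LINT w|lborel. M * exp (- (s * v)) * \<phi> (v - w))"
      by (rule Bochner_Integration.integral_norm_bound_integral[OF _ i]) (rule b)
    also have "\<dots> = M * exp (- (s * v)) * (LINT u|lborel. \<phi> u)"
      using lborel_integral_real_affine[of "-1" \<phi> v] by simp
    finally show ?thesis by (simp add: C2_def \<phi>_def mult_ac)
  qed
  show ?thesis
  proof (rule that[of "M + C + C2"])
    fix v :: real assume v: "v \<ge> 0"
    have "?X v = ?E v + S v - 1 / 2 * conv ?D ?E v"
      unfolding S_def by (subst EX) simp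
    then have "complex_of_real (exp v) * ?X v = complex_of_real (exp v) * ?E v + complex_of_real (exp v) * S v - 1 / 2 * (complex_of_real (exp v) * conv ?D ?E v)"
      by (simp only: ring_distribs mult.left_commute)
    moreover have "complex_of_real (exp v) * of_real (exp (- v) * a) = of_real a" for a
      by (simp add: exp_minus flip: of_real_mult)
    ultimately have "of_real (x v) = of_real (e v) + complex_of_real (exp v) * S v - 1 / 2 * of_real (LINT w|lborel. d (v - w) * e w)"
      unfolding conv_damp damp_def by (simp only:)
    then have "of_real (x v) = of_real (e v) + complex_of_real (exp v) * S v + of_real (- 1 / 2 * (LINT w|lborel. d (v - w) * e w))"
      by simp
    moreover have "norm (a + b + c) \<le> norm a + norm b + norm c" for a b c :: complex
      using norm_triangle_ineq[of "a + b" c] norm_triangle_ineq[of a b] by linarith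
    ultimately have "norm (complex_of_real (x v)) \<le> norm (complex_of_real (e v)) + norm (complex_of_real (exp v) * S v) +
        norm (complex_of_real (- 1 / 2 * (LINT w|lborel. d (v - w) * e w)))"
      by (simp only:)
    then have "\<bar>x v\<bar> \<le> \<bar>e v\<bar> + norm (complex_of_real (exp v) * S v) + \<bar>LINT w|lborel. d (v - w) * e w\<bar>"
      unfolding norm_of_real by (simp add: abs_mult)
    also have "\<bar>e v\<bar> \<le> M * exp (- (\<tau> * v))" using e[of v] v by simp
    also have "\<dots> \<le> M * exp (- (s * v))"
      using M v s by (intro mult_left_mono) (auto intro: mult_right_mono)
    also note S_bound[OF v]
    also note D_bound[of v]
    finally show "\<bar>x v\<bar> \<le> (M + C + C2) * exp (- (s * v))" by (simp add: algebra_simps)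
  qed
qed

section \<open>The partial sums\<close>

lemma sum_by_parts:
  fixes c f :: "nat \<Rightarrow> real"
  shows "(\<Sum>k=0..n. c k * f k) = (\<Sum>k=0..n. c k) * f n + (\<Sum>k<n. (\<Sum>j=0..k. c j) * (f k - f (Suc k)))"
  by (induction n) (simp_all add: algebra_simps)

text \<open>Comparison with the integral of x^(- s), carried out by the mean value theorem for x^(1
  - s) on each unit interval.\<close>

lemma sum_powr_le:
  assumes "0 \<le> s" "s < 1"
  shows "(\<Sum>k<n. real (Suc k) powr (- s)) \<le> real n powr (1 - s) / (1 - s)"
proof (induction n)
  case (Suc n)
  have "(1 - s) * real (Suc n) powr (- s) \<le> real (Suc n) powr (1 - s) - real n powr (1 - s)"
  proof (cases "n = 0")
    case False
    have "\<exists>z. real n < z \<and> z < real (Suc n) \<and>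
        real (Suc n) powr (1 - s) - real n powr (1 - s) = (real (Suc n) - real n) * ((1 - s) * z powr (- s))"
      by (rule MVT2) (use False in \<open>auto intro!: derivative_eq_intros\<close>)
    then obtain z where z: "real n < z" "z < real (Suc n)"
      "real (Suc n) powr (1 - s) - real n powr (1 - s) = (1 - s) * z powr (- s)" by auto
    have "real (Suc n) powr (- s) \<le> z powr (- s)"
      using z assms False by (intro powr_mono2') auto
    then show ?thesis unfolding z(3) using assms by (intro mult_left_mono) auto
  qed (use assms in simp)
  then have "real (Suc n) powr (- s) \<le> (real (Suc n) powr (1 - s) - real n powr (1 - s)) / (1 - s)"
    using assms by (simp add: pos_le_divide_eq mult.commute)
  then show ?case using Suc by (simp add: diff_divide_distrib)
qed simp

lemma nat_floor_bounds:
  fixes X :: real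
  assumes "X \<ge> 1"
  shows "real (nat \<lfloor>X\<rfloor> - 1) + 1 \<le> X" "X < real (nat \<lfloor>X\<rfloor> - 1) + 2"
proof -
  have "\<lfloor>X\<rfloor> \<ge> 1" using assms by simp
  moreover have "int (nat i - 1) = i - 1" if "i \<ge> 1" for i using that by simp
  ultimately have "int (nat \<lfloor>X\<rfloor> - 1) = \<lfloor>X\<rfloor> - 1" by blast
  then have "real (nat \<lfloor>X\<rfloor> - 1) = of_int \<lfloor>X\<rfloor> - 1" by (metis of_int_1 of_int_diff of_int_of_nat_eq)
  then show "real (nat \<lfloor>X\<rfloor> - 1) + 1 \<le> X" "X < real (nat \<lfloor>X\<rfloor> - 1) + 2" by linarith+
qed

locale hilbert_partial_sums =
  fixes C :: "nat \<Rightarrow> real"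
  assumes C_0: "C 0 = 1"
    and C_rec: "N \<ge> 1 \<Longrightarrow> C N = - (\<Sum>k<N. C k * (real (2 * N + 1) / (real (N + k + 1) * real (N + k + 2))))"
begin

lemma abs_C_le_1: "\<bar>C N\<bar> \<le> 1"
proof (induction N rule: less_induct)
  case (less N)
  show ?case
  proof (cases "N = 0")
    case False
    have "\<bar>C N\<bar> \<le> (\<Sum>k<N. \<bar>C k * (real (2 * N + 1) / (real (N + k + 1) * real (N + k + 2)))\<bar>)"
    proof -
      have "C N = - (\<Sum>k<N. C k * (real (2 * N + 1) / (real (N + k + 1) * real (N + k + 2))))"
        by (rule C_rec) (use False in simp)
      then show ?thesis by (simp only: abs_minus_cancel sum_abs)
    qed
    also have "\<dots> \<le> (\<Sum>k<N. 1 * (real (2 * N + 1) / (real (N + k + 1) * real (N + k + 2))))"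
      unfolding abs_mult using less by (intro sum_mono mult_mono) auto
    \<comment> \<open>Partial fractions make the weights telescope.\<close>
    also have "\<dots> = (\<Sum>k<N. - real (2 * N + 1) / real (N + Suc k + 1) - (- real (2 * N + 1) / real (N + k + 1)))"
      by (intro sum.cong refl) (simp add: field_simps)
    also have "\<dots> = - real (2 * N + 1) / real (N + N + 1) - (- real (2 * N + 1) / real (N + 0 + 1))"
      by (rule sum_lessThan_telescope)
    also have "\<dots> = (2 * real N + 1) / (real N + 1) - 1"
    proof -
      have "- real (2 * N + 1) / real (N + N + 1) = - 1" by (simp add: divide_eq_eq)
      moreover have "x - (- a / b) = a / b + x" for x a b :: real by simp
      ultimately show ?thesis by (simp only:) (simp add: add.commute)
    qed
    also have "\<dots> \<le> 1" by (simp add: divide_simps)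
    finally show ?thesis .
  qed (simp add: C_0)
qed

text \<open>
  The index shift puts \<open>C k\<close> on \<open>k + 1 \<le> exp v < k + 2\<close>, so that also \<open>C 0\<close> lives on \<open>v \<ge> 0\<close>; without
  it the term of \<open>C 0\<close> would make the defect decay no faster than \<open>exp (- v)\<close>.
\<close>

definition step :: "real \<Rightarrow> real" where
  "step v = (if v < 0 then 0 else C (nat \<lfloor>exp v\<rfloor> - 1))"

text \<open>Defined as whatever makes the Volterra equation hold exactly; the content lies in its
  decay, proved in \<open>defect_bound\<close>.\<close>

definition defect :: "real \<Rightarrow> real" where
  "defect v = step v + (LINT w|lborel. mult_kernel (v - w) * step w)"

lemma measurable_step [measurable]: "step \<in> borel_measurable borel"
  unfolding step_def by measurable

lemma measurable_defect [measurable]: "defect \<in> borel_measurable borel"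
  unfolding defect_def by measurable

lemma abs_step_le: "\<bar>step v\<bar> \<le> indicator {0..} v * 1"
  using abs_C_le_1 by (simp add: step_def)

lemma step_ln: "step (ln (real (Suc k))) = C k"
proof -
  have "nat \<lfloor>exp (ln (real (Suc k)))\<rfloor> = Suc k" by (subst exp_ln) (simp_all del: of_nat_Suc)
  then show ?thesis unfolding step_def by (simp del: of_nat_Suc exp_ln)
qed

lemma defect_neg: "v < 0 \<Longrightarrow> defect v = 0"
proof -
  assume v: "v < 0"
  have "mult_kernel (v - w) * step w = 0" for w
    using v by (auto simp: mult_kernel_def step_def)
  then have "(LINT w|lborel. mult_kernel (v - w) * step w) = 0" by (simp only: integral_zero)
  then show ?thesis using v by (simp add: defect_def) (simp add: step_def)
qed

text \<open>For w \<le> v the kernel has the antiderivative - 2 X / (X + exp w) with X = exp v. Over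
  the interval from ln (k + 1) to ln (k + 2) this gives 2 X / ((X + k + 1) (X + k + 2)), the
  continuous counterpart of the recurrence weight.\<close>

lemma mult_kernel_integral:
  assumes "a \<le> b" "b \<le> v"
  shows "(LINT w|lborel. indicator {a..<b} w * mult_kernel (v - w)) =
           2 * exp v / (exp v + exp a) - 2 * exp v / (exp v + exp b)"
    and "integrable lborel (\<lambda>w. indicator {a..<b} w * mult_kernel (v - w))"
proof -
  define g where "g w = 2 * exp v * exp w / (exp v + exp w)\<^sup>2" for w
  have pos: "exp v + exp w \<noteq> 0" for w :: real by (smt (verit) exp_gt_zero)
  have k: "mult_kernel (v - w) = g w" if "w \<le> v" for w
  proof -
    have "2 * (b / a) / (1 + b / a)\<^sup>2 = 2 * a * b / (a + b)\<^sup>2" if "a \<noteq> 0" "a + b \<noteq> 0" for a b :: real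
    proof -
      have "1 + b / a = (a + b) / a" using that by (simp add: field_simps)
      then show ?thesis using that by (simp only: power_divide) (simp add: power2_eq_square)
    qed
    from this[OF _ pos] that show ?thesis
      by (simp add: mult_kernel_def g_def exp_diff)
  qed
  have cont: "continuous_on {a..b} g"
    unfolding g_def using pos by (intro continuous_intros) auto
  have ae: "AE w in lborel. indicator {a..b} w *\<^sub>R g w = indicator {a..<b} w * mult_kernel (v - w)"
    using AE_lborel_singleton[of b] by eventually_elim (use assms k in \<open>auto simp: indicator_def\<close>)
  have gm: "(\<lambda>w. indicator {a..b} w *\<^sub>R g w) \<in> borel_measurable lborel" unfolding g_def by measurable
  have "(LINT w|lborel. indicator {a..b} w *\<^sub>R g w) = - (2 * exp v) / (exp v + exp b) - (- (2 * exp v) / (exp v + exp a))"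
  proof (rule integral_FTC_Icc[OF assms(1) _ cont])
    fix w
    have "((\<lambda>w. - (2 * exp v) / (exp v + exp w)) has_real_derivative g w) (at w)"
      unfolding g_def using pos[of w] by (auto intro!: derivative_eq_intros simp: power2_eq_square)
    then show "((\<lambda>w. - (2 * exp v) / (exp v + exp w)) has_vector_derivative g w) (at w within {a..b})"
      by (simp add: has_real_derivative_iff_has_vector_derivative has_vector_derivative_at_within)
  qed
  moreover have "(LINT w|lborel. indicator {a..b} w *\<^sub>R g w) = (LINT w|lborel. indicator {a..<b} w * mult_kernel (v - w))"
    by (rule integral_cong_AE[OF gm _ ae]) simp
  ultimately show "(LINT w|lborel. indicator {a..<b} w * mult_kernel (v - w)) =
           2 * exp v / (exp v + exp a) - 2 * exp v / (exp v + exp b)" by simp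
  have "integrable lborel (\<lambda>w. indicator {a..b} w *\<^sub>R g w)"
    by (rule borel_integrable_compact[OF compact_Icc cont])
  then show "integrable lborel (\<lambda>w. indicator {a..<b} w * mult_kernel (v - w))"
    by (rule integrable_cong_AE_imp) (use ae in simp_all)
qed

lemma defect_eq:
  assumes v: "v \<ge> 0" and N: "real N + 1 \<le> exp v" "exp v < real N + 2"
  shows "defect v = C N + (\<Sum>k<N. C k * (2 * exp v / ((exp v + real k + 1) * (exp v + real k + 2))))
            + C N * (2 * exp v / (exp v + real N + 1) - 1)"
proof -
  \<comment> \<open>The cut at v shortens only the last interval, k = N. Its end point contributes 2
    X / (X + X) = 1, the source of the -1 in the final term.\<close>
  define b where "b k = min (ln (real (k + 2))) v" for k :: nat
  have lnv: "ln (real (Suc k)) \<le> v" if "k \<le> N" for k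
  proof -
    have "real (Suc k) \<le> exp v" using that N by simp
    then have "ln (real (Suc k)) \<le> ln (exp v)" by (intro ln_mono) auto
    then show ?thesis by simp
  qed
  have ab: "ln (real (Suc k)) \<le> b k" "b k \<le> v" if "k \<le> N" for k
    using lnv[OF that] by (auto simp: b_def intro!: ln_mono)
  have flN: "nat \<lfloor>exp v\<rfloor> = Suc N"
  proof -
    have "\<lfloor>exp v\<rfloor> = int N + 1" using N by (intro floor_unique) auto
    then show ?thesis by simp
  qed
  \<comment> \<open>At w = v the kernel has the value 1/2, but none of the half-open intervals
    contains v.\<close>
  have pw: "mult_kernel (v - w) * step w =
      (\<Sum>k\<le>N. C k * (indicator {ln (real (Suc k))..<b k} w * mult_kernel (v - w)))" if "w \<noteq> v" for w
  proof (cases "0 \<le> w \<and> w < v")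
    case True
    define k0 where "k0 = nat \<lfloor>exp w\<rfloor> - 1"
    have e1: "exp w \<ge> 1" using True by simp
    have k0: "real k0 + 1 \<le> exp w" "exp w < real k0 + 2"
      unfolding k0_def by (rule nat_floor_bounds[OF e1])+
    have "k0 \<le> N"
    proof -
      have "exp w < exp v" using True by simp
      then have "real k0 + 1 < real N + 2" using k0 N by linarith
      then show ?thesis by linarith
    qed
    have ind: "indicator {ln (real (Suc k))..<b k} w = (if k = k0 then 1 else 0 :: real)" for k
    proof -
      have "ln (real (Suc k)) \<le> w \<longleftrightarrow> real (Suc k) \<le> exp w"
        by (metis exp_le_cancel_iff exp_ln of_nat_0_less_iff zero_less_Suc)
      moreover have "w < b k \<longleftrightarrow> exp w < real (k + 2)" 
      proof -
        have "w < ln (real (k + 2)) \<longleftrightarrow> exp w < real (k + 2)"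
          by (metis exp_less_cancel_iff exp_ln of_nat_0_less_iff add_2_eq_Suc' zero_less_Suc)
        then show ?thesis using True by (simp add: b_def)
      qed
      moreover have "real (Suc k) \<le> exp w \<and> exp w < real (k + 2) \<longleftrightarrow> k = k0"
        using k0 by auto
      ultimately show ?thesis by (auto simp: indicator_def)
    qed
    have "(\<Sum>k\<le>N. C k * (indicator {ln (real (Suc k))..<b k} w * mult_kernel (v - w))) =
        (\<Sum>k\<le>N. if k = k0 then C k * mult_kernel (v - w) else 0)"
      by (intro sum.cong refl) (simp only: ind, simp)
    also have "\<dots> = C k0 * mult_kernel (v - w)" using \<open>k0 \<le> N\<close> by (simp add: sum.delta)
    finally show ?thesis using True by (simp add: step_def k0_def)
  next
    case False
    have "mult_kernel (v - w) * step w = 0"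
      using False that by (auto simp: mult_kernel_def step_def)
    moreover have "indicator {ln (real (Suc k))..<b k} w = (0::real)" if "k \<le> N" for k
    proof -
      have "ln (real (Suc k)) \<ge> 0" by simp
      then have "\<not> (ln (real (Suc k)) \<le> w \<and> w < b k)" using False ab[OF that] by linarith
      then show ?thesis by (simp add: indicator_def)
    qed
    ultimately show ?thesis by simp
  qed
  have "(LINT w|lborel. mult_kernel (v - w) * step w) =
      (LINT w|lborel. (\<Sum>k\<le>N. C k * (indicator {ln (real (Suc k))..<b k} w * mult_kernel (v - w))))"
  proof (rule integral_cong_AE)
    show "AE w in lborel. mult_kernel (v - w) * step w =
      (\<Sum>k\<le>N. C k * (indicator {ln (real (Suc k))..<b k} w * mult_kernel (v - w)))"
      using AE_lborel_singleton[of v] by eventually_elim (rule pw)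
  qed simp_all
  also have "\<dots> = (\<Sum>k\<le>N. C k * (2 * exp v / (exp v + exp (ln (real (Suc k)))) - 2 * exp v / (exp v + exp (b k))))"
    using mult_kernel_integral[OF ab]
    by (subst Bochner_Integration.integral_sum) (auto intro!: sum.cong)
  also have "\<dots> = (\<Sum>k<N. C k * (2 * exp v / ((exp v + real k + 1) * (exp v + real k + 2))))
            + C N * (2 * exp v / (exp v + real N + 1) - 1)"
  proof -
    have eb: "exp (b k) = real (k + 2)" if "k < N" for k
      using lnv[of "Suc k"] that by (simp add: b_def min_def)
    have bN: "exp (b N) = exp v"
    proof -
      have "v \<le> ln (real (N + 2))" using N by (simp add: ln_ge_iff)
      then show ?thesis by (simp add: b_def min_def)
    qed
    have t: "C k * (2 * exp v / (exp v + exp (ln (real (Suc k)))) - 2 * exp v / (exp v + exp (b k)))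
       = C k * (2 * exp v / ((exp v + real k + 1) * (exp v + real k + 2)))" if "k < N" for k
    proof -
      have p: "exp v + real k + 1 \<noteq> 0" "exp v + real k + 2 \<noteq> 0" by (smt (verit) exp_gt_zero of_nat_0_le_iff)+
      have "2 * exp v / (exp v + real k + 1) - 2 * exp v / (exp v + real k + 2) =
          2 * exp v / ((exp v + real k + 1) * (exp v + real k + 2))"
        using p by (simp add: divide_simps) (simp add: algebra_simps)
      then show ?thesis unfolding eb[OF that] by (simp add: add_ac)
    qed
    have "2 * exp v / (exp v + exp v) = 1" by simp
    then show ?thesis
      unfolding lessThan_Suc_atMost[symmetric] sum.lessThan_Suc bN
      using t by (simp add: add_ac)
  qed
  finally show ?thesis using v flN by (simp add: defect_def step_def)
qed

text \<open>With u = N + k + 1 and X = N + 1 + \<theta>, the terms m u^2 cancel in the numerator of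
  the difference. What is left is O(u^2) over a denominator of size at least u^4.\<close>

lemma kernel_difference:
  fixes N k :: nat and X :: real
  assumes N: "real N + 1 \<le> X" "X < real N + 2"
  shows "\<bar>2 * X / ((X + real k + 1) * (X + real k + 2)) - real (2 * N + 1) / (real (N + k + 1) * real (N + k + 2))\<bar> \<le> 116 / X\<^sup>2"
proof -
  define u m \<theta> where "u = real (N + k + 1)" and "m = real N + 1" and "\<theta> = X - m"
  have \<theta>: "0 \<le> \<theta>" "\<theta> < 1" and m: "1 \<le> m" "m \<le> u" using N by (auto simp: \<theta>_def m_def u_def)
  have X: "X = m + \<theta>" "X + real k + 1 = u + 1 + \<theta>" "X + real k + 2 = u + 2 + \<theta>"
    "real (2 * N + 1) = 2 * m - 1" "real (N + k + 2) = u + 1"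
    by (auto simp: \<theta>_def m_def u_def)
  define n where "n = u\<^sup>2 * (2 * \<theta> + 1) + u * (2 * m + 2 * \<theta> - (2 * m - 1) * (3 + 2 * \<theta>)) - (2 * m - 1) * ((1 + \<theta>) * (2 + \<theta>))"
  \<comment> \<open>29 = 3 + 14 + 12, one summand for each of the three terms of n.\<close>
  have nb: "\<bar>n\<bar> \<le> 29 * u\<^sup>2"
  proof -
    have a1: "0 \<le> (2 * m - 1) * (3 + 2 * \<theta>)" "(2 * m - 1) * (3 + 2 * \<theta>) \<le> (2 * u) * 5"
      using \<theta> m by simp (rule mult_mono; use \<theta> m in simp)
    have "\<bar>2 * m + 2 * \<theta> - (2 * m - 1) * (3 + 2 * \<theta>)\<bar> \<le> 14 * u"
      using a1 \<theta> m by linarith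
    then have 1: "u * \<bar>2 * m + 2 * \<theta> - (2 * m - 1) * (3 + 2 * \<theta>)\<bar> \<le> u * (14 * u)"
      using m by (intro mult_left_mono) auto
    have "(1 + \<theta>) * (2 + \<theta>) \<le> 2 * 3" using \<theta> by (intro mult_mono) auto
    then have "(2 * m - 1) * ((1 + \<theta>) * (2 + \<theta>)) \<le> (2 * u) * 6"
      using \<theta> m by (intro mult_mono) auto
    also have "\<dots> \<le> (2 * u) * (6 * u)" using m by (intro mult_left_mono) auto
    finally have 2: "(2 * m - 1) * ((1 + \<theta>) * (2 + \<theta>)) \<le> 12 * u\<^sup>2" by (simp add: power2_eq_square)
    have 3: "0 \<le> (2 * m - 1) * ((1 + \<theta>) * (2 + \<theta>))" using \<theta> m by auto
    have 4: "u\<^sup>2 * (2 * \<theta> + 1) \<le> u\<^sup>2 * 3" "0 \<le> u\<^sup>2 * (2 * \<theta> + 1)" using \<theta> by (auto intro!: mult_left_mono)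
    have "\<bar>n\<bar> \<le> \<bar>u\<^sup>2 * (2 * \<theta> + 1)\<bar> + \<bar>u * (2 * m + 2 * \<theta> - (2 * m - 1) * (3 + 2 * \<theta>))\<bar> + \<bar>(2 * m - 1) * ((1 + \<theta>) * (2 + \<theta>))\<bar>"
      unfolding n_def by linarith
    also have "\<bar>u * (2 * m + 2 * \<theta> - (2 * m - 1) * (3 + 2 * \<theta>))\<bar> \<le> 14 * u\<^sup>2"
      using 1 m by (simp add: abs_mult power2_eq_square)
    also have "\<bar>(2 * m - 1) * ((1 + \<theta>) * (2 + \<theta>))\<bar> \<le> 12 * u\<^sup>2" using 2 3 by linarith
    also have "\<bar>u\<^sup>2 * (2 * \<theta> + 1)\<bar> \<le> 3 * u\<^sup>2" using 4 by linarith
    finally show ?thesis by linarith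
  qed
  define d where "d = (u + 1 + \<theta>) * (u + 2 + \<theta>) * (u * (u + 1))"
  have d: "d \<ge> u\<^sup>2 * u\<^sup>2" unfolding d_def power2_eq_square
    using \<theta> m by (intro mult_mono) auto
  have u2: "u\<^sup>2 * u\<^sup>2 > 0" using m by simp
  have "2 * X / ((X + real k + 1) * (X + real k + 2)) - real (2 * N + 1) / (real (N + k + 1) * real (N + k + 2))
      = 2 * (m + \<theta>) / ((u + 1 + \<theta>) * (u + 2 + \<theta>)) - (2 * m - 1) / (u * (u + 1))"
    unfolding X(2) X(3) X(4) X(5) u_def[symmetric] by (simp only: X(1)[symmetric])
  also have "\<dots> = (2 * (m + \<theta>) * (u * (u + 1)) - (2 * m - 1) * ((u + 1 + \<theta>) * (u + 2 + \<theta>))) / d"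
    unfolding d_def using m \<theta> by (subst diff_frac_eq) auto
  also have "2 * (m + \<theta>) * (u * (u + 1)) - (2 * m - 1) * ((u + 1 + \<theta>) * (u + 2 + \<theta>)) = n"
    unfolding n_def by (simp add: algebra_simps power2_eq_square)
  also have "\<bar>n / d\<bar> \<le> 29 * u\<^sup>2 / (u\<^sup>2 * u\<^sup>2)"
  proof -
    have "d > 0" using d u2 by linarith
    then have "\<bar>n / d\<bar> = \<bar>n\<bar> / d" by simp
    also have "\<dots> \<le> 29 * u\<^sup>2 / (u\<^sup>2 * u\<^sup>2)" by (rule frac_le[OF _ nb u2 d]) simp
    finally show ?thesis .
  qed
  also have "\<dots> = 29 / u\<^sup>2" using m by (simp add: divide_simps)
  \<comment> \<open>116 = 4 * 29, because X \<le> 2 u.\<close>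
  also have "\<dots> \<le> 116 / X\<^sup>2"
  proof -
    have "X \<le> 2 * u" using X(1) \<theta> m by linarith
    then have "X\<^sup>2 \<le> (2 * u)\<^sup>2" using X(1) \<theta> m by (intro power_mono) auto
    moreover have "X > 0" using X(1) \<theta> m by linarith
    ultimately show ?thesis using m by (simp add: divide_simps power_mult_distrib)
  qed
  finally show ?thesis .
qed

text \<open>The recurrence eliminates \<open>C N\<close>, so each \<open>C k\<close> is multiplied
  only by a kernel difference of size 1 / X^2. As s < 1, the sum of (k + 1)^(- s) over k < N is
  O(X^(1 - s)), which makes the total O(X^(- (1 + s))). The truncated last interval contributes
  \<open>C N\<close> times O(1 / X), of the same order.\<close>

lemma defect_bound:
  assumes s: "0 \<le> s" "s < 1" and C: "\<And>k. \<bar>C k\<bar> \<le> A * real (Suc k) powr (- s)"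
  obtains M where "\<And>v. \<bar>defect v\<bar> \<le> indicator {0..} v * (M * exp (- ((1 + s) * v)))"
proof -
  have A: "A \<ge> 1" using C[of 0] C_0 by simp
  define M where "M = 116 * A / (1 - s) + 16 * A"
  show ?thesis
  proof (rule that[of M])
    fix v :: real
    show "\<bar>defect v\<bar> \<le> indicator {0..} v * (M * exp (- ((1 + s) * v)))"
    proof (cases "v \<ge> 0")
      case True
      define X where "X = exp v"
      define N where "N = nat \<lfloor>X\<rfloor> - 1"
      have X1: "X \<ge> 1" using True by (simp add: X_def)
      have N: "real N + 1 \<le> X" "X < real N + 2"
        unfolding N_def by (rule nat_floor_bounds[OF X1])+
      have Xp: "X powr p = exp (p * v)" for p by (simp add: X_def powr_def)
      have CN: "\<bar>C N\<bar> \<le> 2 * A * X powr (- s)"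
      proof -
        have "real (Suc N) powr (- s) \<le> (X / 2) powr (- s)"
          using N X1 s by (intro powr_mono2') auto
        also have "\<dots> = X powr (- s) * 2 powr s" using X1 by (simp add: powr_divide powr_minus field_simps)
        also have "\<dots> \<le> X powr (- s) * 2 powr 1" using s by (intro mult_left_mono powr_mono) auto
        finally have "A * real (Suc N) powr (- s) \<le> A * (X powr (- s) * 2 powr 1)"
          using A by (intro mult_left_mono) auto
        then show ?thesis using C[of N] by simp
      qed
      have last: "\<bar>C N * (2 * X / (X + real N + 1) - 1)\<bar> \<le> 2 * A * X powr (- s) * (1 / X)"
      proof -
        have "2 * X / (X + real N + 1) - 1 = (X - real N - 1) / (X + real N + 1)"
          using X1 by (simp add: field_simps)
        also have "\<bar>\<dots>\<bar> \<le> 1 / X"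
        proof -
          have "\<bar>(X - real N - 1) / (X + real N + 1)\<bar> = (X - real N - 1) / (X + real N + 1)"
            using N X1 by simp
          also have "\<dots> \<le> 1 / X" using N X1 by (intro frac_le) auto
          finally show ?thesis .
        qed
        finally show ?thesis unfolding abs_mult using CN by (intro mult_mono) auto
      qed
      have Xm: "X powr (- s) * (1 / X) = X powr (- (1 + s))"
        using X1 powr_add[of X "- 1" "- s"] by (simp add: powr_minus_divide)
      have "\<bar>defect v\<bar> \<le> 116 * A / (1 - s) * X powr (- (1 + s)) + 16 * A * X powr (- (1 + s))"
      \<comment> \<open>The recurrence starts at N = 1. For N = 0 one has X < 2, where X powr (- (1
        + s)) is at least 1/4 and a constant bound suffices.\<close>
      proof (cases "N = 0")
        case True
        have "defect v = C 0 * (2 * X / (X + 1))"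
          using defect_eq[OF \<open>v \<ge> 0\<close> N[unfolded X_def]] True by (simp add: X_def algebra_simps)
        also have "\<bar>\<dots>\<bar> \<le> 2" using X1 by (simp add: C_0 abs_mult) (simp add: divide_simps)
        also have "\<dots> \<le> 16 * A * X powr (- (1 + s))"
        proof -
          have "X powr (1 + s) \<le> 2 powr (1 + s)" using N True X1 s by (intro powr_mono2) auto
          also have "\<dots> \<le> 2 powr 2" using s by (intro powr_mono) auto
          finally have "X powr (1 + s) \<le> 4" by simp
          then have "1 / 4 \<le> 1 / X powr (1 + s)" using X1 by (intro divide_left_mono) auto
          then have "1 / 4 \<le> X powr (- (1 + s))" by (simp only: powr_minus_divide)
          then have "16 * 1 * (1 / 4) \<le> 16 * A * X powr (- (1 + s))" using A by (intro mult_mono) auto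
          then show ?thesis by simp
        qed
        also have "\<dots> \<le> 116 * A / (1 - s) * X powr (- (1 + s)) + 16 * A * X powr (- (1 + s))"
          using A s by simp
        finally show ?thesis .
      next
        case False
        let ?a = "\<lambda>k. 2 * X / ((X + real k + 1) * (X + real k + 2))"
        let ?b = "\<lambda>k. real (2 * N + 1) / (real (N + k + 1) * real (N + k + 2))"
        have "defect v = C N + (\<Sum>k<N. C k * ?a k) + C N * (2 * X / (X + real N + 1) - 1)"
          using defect_eq[OF \<open>v \<ge> 0\<close> N[unfolded X_def]] by (simp only: X_def)
        also have "C N + (\<Sum>k<N. C k * ?a k) = (\<Sum>k<N. C k * (?a k - ?b k))"
          using C_rec[of N] False by (simp add: sum_subtractf right_diff_distrib)
        finally have "\<bar>defect v\<bar> \<le> \<bar>\<Sum>k<N. C k * (?a k - ?b k)\<bar> + \<bar>C N * (2 * X / (X + real N + 1) - 1)\<bar>"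
          by linarith
        also have "\<bar>\<Sum>k<N. C k * (?a k - ?b k)\<bar> \<le> (\<Sum>k<N. \<bar>C k * (?a k - ?b k)\<bar>)" by (rule sum_abs)
        also have "\<dots> \<le> (\<Sum>k<N. (A * real (Suc k) powr (- s)) * (116 / X\<^sup>2))"
          unfolding abs_mult using A by (intro sum_mono mult_mono C kernel_difference N) auto
        also have "\<dots> = 116 * A / X\<^sup>2 * (\<Sum>k<N. real (Suc k) powr (- s))"
          unfolding sum_distrib_left by (intro sum.cong refl) simp
        also have "\<dots> \<le> 116 * A / X\<^sup>2 * (real N powr (1 - s) / (1 - s))"
          using A by (intro mult_left_mono sum_powr_le s) auto
        also have "\<dots> \<le> 116 * A / X\<^sup>2 * (X powr (1 - s) / (1 - s))"
          using A N s by (intro mult_left_mono divide_right_mono powr_mono2) auto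
        also have "\<dots> = 116 * A / (1 - s) * (X powr (1 - s) / X\<^sup>2)" by simp
        also have "X powr (1 - s) / X\<^sup>2 = X powr (- (1 + s))"
        proof -
          have "X\<^sup>2 = X powr 2" using X1 by (simp add: powr_numeral)
          then show ?thesis by (simp add: powr_diff[symmetric])
        qed
        also note last
        also have "2 * A * X powr (- s) * (1 / X) \<le> 16 * A * X powr (- (1 + s))"
          unfolding mult.assoc Xm using A by (intro mult_mono) auto
        finally show ?thesis by simp
      qed
      also have "\<dots> = M * exp (- ((1 + s) * v))"
        unfolding Xp M_def by (simp add: algebra_simps)
      finally show ?thesis using True by simp
    qed (simp add: defect_neg)
  qed
qed

lemma C_bound_of_defect_bound:
  assumes "\<And>v. \<bar>defect v\<bar> \<le> indicator {0..} v * (M * exp (- (\<tau> * v)))" "0 < s" "s < \<tau>" "s < alpha1"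
  obtains A where "\<And>k. \<bar>C k\<bar> \<le> A * real (Suc k) powr (- s)"
proof -
  obtain A where A: "\<And>v. v \<ge> 0 \<Longrightarrow> \<bar>step v\<bar> \<le> A * exp (- (s * v))"
    using volterra_decay[OF measurable_step measurable_defect abs_step_le assms(1) defect_def assms(2-4)] by blast
  show ?thesis
  proof (rule that[of A])
    fix k
    show "\<bar>C k\<bar> \<le> A * real (Suc k) powr (- s)"
      using A[of "ln (real (Suc k))"] unfolding step_ln by (simp add: powr_def)
  qed
qed

theorem C_bound:
  assumes s: "0 < s" "s < alpha1"
  obtains A where "\<And>k. \<bar>C k\<bar> \<le> A * real (Suc k) powr (- s)"
proof -
  \<comment> \<open>The exponent s / 2 is below the rate 1 of the first defect bound and is
    admissible in \<open>defect_bound\<close>; the improved rate 1 + s / 2 exceeds s exactly when s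
    < 2.\<close>
  have s2: "s / 2 < 1" "s < 2" using s alpha1_less_2 by auto
  obtain M where M: "\<And>v. \<bar>defect v\<bar> \<le> indicator {0..} v * (M * exp (- ((1 + 0) * v)))"
    by (rule defect_bound[of 0 1]) (use abs_C_le_1 in auto)
  obtain A where A: "\<And>k. \<bar>C k\<bar> \<le> A * real (Suc k) powr (- (s / 2))"
    by (rule C_bound_of_defect_bound[OF M, of "s / 2"]) (use s s2 in auto)
  obtain M' where M': "\<And>v. \<bar>defect v\<bar> \<le> indicator {0..} v * (M' * exp (- ((1 + s / 2) * v)))"
    by (rule defect_bound[OF _ _ A]) (use s s2 in auto)
  show ?thesis
    by (rule C_bound_of_defect_bound[OF M', of s]) (use s s2 that in auto)
qed

end

section \<open>From the rational sequence to the decay of its partial sums\<close>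

theorem theorem1p1:
  fixes c C :: "nat \<Rightarrow> rat"
  assumes "c 0 = 1"
    and "\<And>N. N \<ge> 1 \<Longrightarrow> (\<Sum>k=0..N. c k / of_nat (N + k + 1)) = 0"
    and "\<And>N. C N = (\<Sum>k=0..N. c k)"
  shows "\<forall>\<epsilon>>0. (\<lambda>N. real_of_rat (C N)) \<in> O(\<lambda>N. real N powr (- alpha1 + \<epsilon>))"
proof (intro allI impI)
  fix \<epsilon> :: real assume \<epsilon>: "\<epsilon> > 0"
  define D where "D N = real_of_rat (C N)" for N
  interpret hilbert_partial_sums D
  proof
    show "D 0 = 1" using assms by (simp add: D_def)
    fix N :: nat assume N: "N \<ge> 1"
    define f where "f k = 1 / real (N + k + 1)" for k
    have D: "(\<Sum>j=0..k. real_of_rat (c j)) = D k" for k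
      by (simp add: D_def assms(3) of_rat_sum)
    have "0 = real_of_rat (\<Sum>k=0..N. c k / of_nat (N + k + 1))" using assms(2)[OF N] by simp
    also have "\<dots> = (\<Sum>k=0..N. real_of_rat (c k) * f k)"
      by (simp add: of_rat_sum of_rat_divide f_def of_rat_add)
    also have "\<dots> = D N * f N + (\<Sum>k<N. D k * (f k - f (Suc k)))"
      unfolding sum_by_parts D ..
    finally have "D N = - (\<Sum>k<N. D k * (f k - f (Suc k))) / f N"
      by (simp add: f_def field_simps)
    also have "\<dots> = - (\<Sum>k<N. D k * (real (2 * N + 1) / (real (N + k + 1) * real (N + k + 2))))"
    proof -
      have "(f k - f (Suc k)) / f N = real (2 * N + 1) / (real (N + k + 1) * real (N + k + 2))" for k
        unfolding f_def by (simp add: divide_simps)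
      then show ?thesis by (simp only: sum_divide_distrib minus_divide_left[symmetric] times_divide_eq_right[symmetric])
    qed
    finally show "D N = - (\<Sum>k<N. D k * (real (2 * N + 1) / (real (N + k + 1) * real (N + k + 2))))" .
  qed
  show "(\<lambda>N. real_of_rat (C N)) \<in> O(\<lambda>N. real N powr (- alpha1 + \<epsilon>))"
  \<comment> \<open>If \<epsilon> \<ge> \<open>alpha1\<close>, the exponent is nonnegative and the
    bound by 1 is enough. Otherwise \<open>alpha1 - \<epsilon>\<close> lies strictly between 0 and
    \<open>alpha1\<close>, as \<open>C_bound\<close> requires.\<close>
  proof (cases "\<epsilon> < alpha1")
    case False
    show ?thesis
    proof (rule bigoI[of _ 1])
      show "\<forall>\<^sub>F N in at_top. norm (real_of_rat (C N)) \<le> 1 * norm (real N powr (- alpha1 + \<epsilon>))"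
        using eventually_ge_at_top[of 1]
      proof eventually_elim
        case (elim N)
        have "norm (real_of_rat (C N)) \<le> 1" using abs_C_le_1[of N] by (simp add: D_def)
        also have "1 \<le> real N powr (- alpha1 + \<epsilon>)" using elim False by (intro ge_one_powr_ge_zero) auto
        finally show ?case by simp
      qed
    qed
  next
    case True
    obtain A where A: "\<And>k. \<bar>D k\<bar> \<le> A * real (Suc k) powr (- (alpha1 - \<epsilon>))"
      by (rule C_bound[of "alpha1 - \<epsilon>"]) (use True \<epsilon> in auto)
    have A0: "A \<ge> 0" using order_trans[OF abs_ge_zero A[of 0]] by simp
    show ?thesis
    proof (rule bigoI[of _ A])
      show "\<forall>\<^sub>F N in at_top. norm (real_of_rat (C N)) \<le> A * norm (real N powr (- alpha1 + \<epsilon>))"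
        using eventually_ge_at_top[of 1]
      proof eventually_elim
        case (elim N)
        have "norm (real_of_rat (C N)) \<le> A * real (Suc N) powr (- (alpha1 - \<epsilon>))"
          using A[of N] by (simp add: D_def)
        also have "\<dots> \<le> A * real N powr (- (alpha1 - \<epsilon>))"
          using A0 elim True by (intro mult_left_mono powr_mono2') auto
        finally show ?case by simp
      qed
    qed
  qed
qed

end
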